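(* Let $b$ be a connected locally finite weighted graph over an at most countable set $V$ with values in an ordered field $\mathbb K$, let $\pi=\pi_V^b$ be the associated real transition matrix, and let $C\subseteq V$ be a strongly connected component (with respect to $V$). (a) $C$ is recurrent if and only if $C$ is essential and $G(a)=\infty$ for some (all) $a\in C$. (b) $C$ is transient if and only if $C$ is non-essential or $G(a)<\infty$ for some (all) $a\in C$.
   Context: "For some (all)" means that the statement holds with either quantifier. Let $(\mathbb K,\succ)$ be an ordered field and $\mathbb K^+=\{k\succ 0\}$; $\mathbb Q^+$ are the positive rationals. For $k_1,k_2\in\mathbb K^+$ write $k_1\simeq k_2$ if $c_1\prec k_1/k_2\prec c_2$ for some $c_1,c_2\in\mathbb Q^+$. Weighted graph: a symmetric map $b:V\times V\to\mathbb K^+\cup\{0\}$ with $b(x,x)=0$; $x\sim y$ means $b(x,y)\succ 0$. A path is a finite sequence $x_0\sim x_1\sim\dots\sim x_n$ ($n=0$ allowed). Connected: any two vertices are joined by a path. Locally finite: every vertex has finitely many neighbors. A subset is connected if the restriction of $b$ to it is connected. Put $b(x)=\sum_{y\in V}b(x,y)$ and $p(x,y)=b(x,y)/b(x)$ ($b(x)\succ0$ is automatic when $V$ has at least two elements). Real part: for $k\in\mathbb K$ with $|k|\prec c$ for some $c\in\mathbb Q^+$, $\rho(k)$ is the unique real number such that $|k-\rho(k)|$ is smaller than every positive rational in an ordered field containing $\mathbb K$ and $\mathbb R$. $\pi_V^b(x,y)=\rho(p(x,y))$ for $x,y\in V$; this is a real transition matrix. A vertex $x$ is recurrent if the Markov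 chain $(X_n)$ with transition matrix $\pi_V^b$ started at $x$ satisfies $\mathbb P[X_n=x\text{ for infinitely many }n]=1$, and transient otherwise. A component is called recurrent (transient) if its vertices are recurrent (transient); all vertices of a component have the same type. A strongly connected component (with respect to $V$) is a maximal subset $C\subseteq V$ such that for any $x,y\in C$ there is a path $x=x_0\sim\dots\sim x_n=y$ in $V$ with $b(x)\simeq b(x_i,x_{i+1})\simeq b(y)$ for all $i=0,\dots,n-1$. It is essential if for every $x\in C$ and every path $x=x_0\sim\dots\sim x_n=y$ in $V$ with $b(x_i,x_{i+1})\simeq b(x_i)$ for all $i=0,\dots,n-1$ one has $b(x)\simeq b(y)$; otherwise it is non-essential. Capacity: $\Delta f(x)=\frac1{b(x)}\sum_{y}b(x,y)(f(x)-f(y))$ for $f:V\to\mathbb K$. For finite connected $K\subseteq V$ and $a\in K$ let $v:V\to\mathbb K$ be the unique solution of $\Delta v=0$ on $K\setminus\{a\}$, $v(a)=1$, $v=0$ on $V\setminus K$. Put $\operatorname{cap}_K(a)=b(a)\Delta v(a)$. Then $0\preceq\operatorname{cap}_K(a)/b(a)\preceq1$, and $G_K(a)=1/\rho\big(\operatorname{cap}_K(a)/b(a)\big)\in[1,\infty]$ with $1/0=\infty$. For an exhaustion $(K_n)$ of $V$ (increasing sequence of finite connected sets with union $V$) with $a\in K_0$, $G(a)=\limsup_{n\to\infty}G_{K_n}(a)\in[1,\infty]$ (the sequence is monotone increasing, so this is a limit). *)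

theory Defs
  imports "HOL-Probability.Probability"
begin

subsection \<open>Ordered fields\<close>

text \<open>The relation \<open>k\<^sub>1 \<simeq> k\<^sub>2\<close> on positive elements.\<close>

definition comparable :: "'k::linordered_field \<Rightarrow> 'k \<Rightarrow> bool" where
  "comparable k1 k2 \<longleftrightarrow> 0 < k1 \<and> 0 < k2 \<and>
     (\<exists>c1 c2 :: rat. 0 < c1 \<and> 0 < c2 \<and> of_rat c1 < k1 / k2 \<and> k1 / k2 < of_rat c2)"

text \<open>
  \<open>infinitely_close k r\<close> says that \<open>\<bar>k - r\<bar>\<close> is smaller than every positive rational.
  The difference lives in an ordered field containing both \<open>'k\<close> and the reals; it is expressed
  here through rational approximations, so that no such field has to be chosen.
  Lemma \<open>infinitely_close_iff\<close> below shows that this is the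
  same as the condition in any common ordered extension field.
\<close>

definition infinitely_close :: "'k::linordered_field \<Rightarrow> real \<Rightarrow> bool" where
  "infinitely_close k r \<longleftrightarrow>
     (\<forall>e::rat. 0 < e \<longrightarrow> (\<exists>q::rat. \<bar>k - of_rat q\<bar> < of_rat e \<and> \<bar>r - of_rat q\<bar> < of_rat e))"

definition real_part :: "'k::linordered_field \<Rightarrow> real" where
  "real_part k = (THE r. infinitely_close k r)"

lemma field_hom_of_rat:
  fixes f :: "'a::field_char_0 \<Rightarrow> 'b::field_char_0"
  assumes f: "f 1 = 1" "\<And>x y. f (x + y) = f x + f y" "\<And>x y. f (x * y) = f x * f y"
  shows "f (of_rat q) = of_rat q" "f (x - y) = f x - f y"
proof -
  have diff: "f (x - y) = f x - f y" for x y
    using f(2)[of "x - y" y] by simp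
  have zero: "f 0 = 0"
    using f(2)[of 0 0] by simp
  have nat: "f (of_nat n) = of_nat n" for n
    by (induction n) (simp_all add: f zero)
  have int: "f (of_int n) = of_int n" for n
    by (cases n rule: int_diff_cases) (simp add: diff nat)
  obtain a b where q: "q = Fract a b" "b > 0"
    by (cases q) auto
  have "f (of_rat q) * f (of_int b) = f (of_rat q * of_int b)"
    by (simp add: f)
  also have "of_rat q * of_int b = (of_int a :: 'a)"
    using q by (simp add: of_rat_rat)
  finally show "f (of_rat q) = of_rat q"
    using q by (simp add: of_rat_rat int field_simps)
  show "f (x - y) = f x - f y" by (rule diff)
qed

lemma infinitely_close_iff:
  fixes \<iota> :: "'k::linordered_field \<Rightarrow> 'l::linordered_field" and \<kappa> :: "real \<Rightarrow> 'l"
  assumes \<iota>: "\<iota> 1 = 1" "\<And>x y. \<iota> (x + y) = \<iota> x + \<iota> y" "\<And>x y. \<iota> (x * y) = \<iota> x * \<iota> y"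
      "\<And>x y. x < y \<Longrightarrow> \<iota> x < \<iota> y"
    and \<kappa>: "\<kappa> 1 = 1" "\<And>x y. \<kappa> (x + y) = \<kappa> x + \<kappa> y" "\<And>x y. \<kappa> (x * y) = \<kappa> x * \<kappa> y"
      "\<And>x y. x < y \<Longrightarrow> \<kappa> x < \<kappa> y"
  shows "infinitely_close k r \<longleftrightarrow> (\<forall>e::rat. 0 < e \<longrightarrow> \<bar>\<iota> k - \<kappa> r\<bar> < of_rat e)"
proof -
  note hom_\<iota> = field_hom_of_rat[of \<iota>, OF \<iota>(1-3)] and hom_\<kappa> = field_hom_of_rat[of \<kappa>, OF \<kappa>(1-3)]
  have less_\<iota>: "\<iota> x < \<iota> y \<longleftrightarrow> x < y" for x y
    using \<iota>(4)[of x y] \<iota>(4)[of y x] by (cases x y rule: linorder_cases) auto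
  have less_\<kappa>: "\<kappa> x < \<kappa> y \<longleftrightarrow> x < y" for x y
    using \<kappa>(4)[of x y] \<kappa>(4)[of y x] by (cases x y rule: linorder_cases) auto
  have abs_\<iota>: "\<bar>\<iota> k - of_rat q\<bar> < of_rat e \<longleftrightarrow> \<bar>k - of_rat q\<bar> < of_rat e" for q e
    using less_\<iota>[of "k - of_rat q" "of_rat e"] less_\<iota>[of "of_rat q - k" "of_rat e"]
    by (simp add: hom_\<iota> abs_less_iff)
  have abs_\<kappa>: "\<bar>\<kappa> r - of_rat q\<bar> < of_rat e \<longleftrightarrow> \<bar>r - of_rat q\<bar> < of_rat e" for q e
    using less_\<kappa>[of "r - of_rat q" "of_rat e"] less_\<kappa>[of "of_rat q - r" "of_rat e"]
    by (simp add: hom_\<kappa> abs_less_iff)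
  have half: "of_rat (e / 2) + of_rat (e / 2) = (of_rat e :: 'l)" for e
    by (simp flip: of_rat_add)
  show ?thesis
  proof (intro iffI allI impI)
    fix e :: rat
    assume "infinitely_close k r" "0 < e"
    then obtain q where "\<bar>k - of_rat q\<bar> < of_rat (e / 2)" "\<bar>r - of_rat q\<bar> < of_rat (e / 2)"
      unfolding infinitely_close_def by (meson half_gt_zero)
    then have "\<bar>\<iota> k - of_rat q\<bar> < of_rat (e / 2)" "\<bar>\<kappa> r - of_rat q\<bar> < of_rat (e / 2)"
      by (simp_all add: abs_\<iota> abs_\<kappa>)
    then show "\<bar>\<iota> k - \<kappa> r\<bar> < of_rat e"
      using half[of e] by linarith
  next
    assume *: "\<forall>e::rat. 0 < e \<longrightarrow> \<bar>\<iota> k - \<kappa> r\<bar> < of_rat e"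
    show "infinitely_close k r"
      unfolding infinitely_close_def
    proof (intro allI impI)
      fix e :: rat
      assume e: "0 < e"
      then have "r < r + of_rat (e / 2)" by simp
      then obtain q where q: "r < of_rat q" "of_rat q < r + of_rat (e / 2)"
        using of_rat_dense by blast
      then have 1: "\<bar>r - of_rat q\<bar> < of_rat (e / 2)" by linarith
      then have "\<bar>\<kappa> r - of_rat q\<bar> < of_rat (e / 2)" by (simp add: abs_\<kappa>)
      moreover have "\<bar>\<iota> k - \<kappa> r\<bar> < of_rat (e / 2)" using * e by simp
      ultimately have "\<bar>\<iota> k - of_rat q\<bar> < of_rat e" using half[of e] by linarith
      moreover have "\<bar>r - of_rat q\<bar> < of_rat e"
        using 1 of_rat_less[of "e / 2" e, where 'a = real] e by linarith
      ultimately show "\<exists>q. \<bar>k - of_rat q\<bar> < of_rat e \<and> \<bar>r - of_rat q\<bar> < of_rat e"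
        by (auto simp: abs_\<iota>)
    qed
  qed
qed

lemma infinitely_close_unique_ex:
  fixes k :: "'k::linordered_field"
  assumes "\<bar>k\<bar> < of_rat c"
  shows "\<exists>!r. infinitely_close k r"
proof (rule ex_ex1I)
  define S where "S = {real_of_rat q | q. of_rat q < k}"
  have up: "real_of_rat q \<le> of_rat c" if "of_rat q < k" for q
  proof -
    have "(of_rat q :: 'k) < of_rat c" using that assms by linarith
    then show ?thesis by (simp add: of_rat_less of_rat_less_eq)
  qed
  then have bdd: "bdd_above S" by (auto simp: S_def bdd_above_def)
  have "(of_rat (- c) :: 'k) < k" using assms by (simp add: of_rat_minus)
  then have ne: "S \<noteq> {}" by (auto simp: S_def)
  have "infinitely_close k (Sup S)"
    unfolding infinitely_close_def
  proof (intro allI impI)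
    fix e :: rat
    assume e: "0 < e"
    then have "Sup S - of_rat (e / 2) < Sup S" by simp
    then obtain y where "y \<in> S" "Sup S - of_rat (e / 2) < y"
      using less_cSup_iff[OF ne bdd] by blast
    then obtain q where q: "of_rat q < k" "Sup S - of_rat (e / 2) < of_rat q"
      unfolding S_def by blast
    have le: "of_rat q \<le> Sup S" using q(1) bdd by (auto simp: S_def intro: cSup_upper)
    have "\<not> of_rat (q + e / 2) < k"
    proof
      assume "of_rat (q + e / 2) < k"
      then have "real_of_rat (q + e / 2) \<le> Sup S" using bdd
        unfolding S_def by (intro cSup_upper) blast+
      with q(2) show False by (simp add: of_rat_add)
    qed
    then have "k \<le> of_rat q + of_rat (e / 2)" by (simp add: of_rat_add)
    moreover have "(of_rat (e / 2) :: 'k) < of_rat e" using e by (simp add: of_rat_less)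
    moreover have "(of_rat (e / 2) :: real) < of_rat e" using e by (simp add: of_rat_less)
    ultimately have "\<bar>k - of_rat q\<bar> < of_rat e" "\<bar>Sup S - of_rat q\<bar> < of_rat e"
      using q le by linarith+
    then show "\<exists>q. \<bar>k - of_rat q\<bar> < of_rat e \<and> \<bar>Sup S - of_rat q\<bar> < of_rat e" by blast
  qed
  then show "\<exists>r. infinitely_close k r" ..
next
  have le: "r \<le> r'" if *: "infinitely_close k r" "infinitely_close k r'" for r r'
  proof (rule ccontr)
    assume "\<not> r \<le> r'"
    then obtain e where e: "0 < real_of_rat e" "real_of_rat e < (r - r') / 4"
      using of_rat_dense[of 0 "(r - r') / 4"] by auto
    then have e0: "0 < e" by simp
    obtain q where q: "\<bar>k - of_rat q\<bar> < of_rat e" "\<bar>r - of_rat q\<bar> < of_rat e"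
      using * e0 unfolding infinitely_close_def by blast
    obtain q' where q': "\<bar>k - of_rat q'\<bar> < of_rat e" "\<bar>r' - of_rat q'\<bar> < of_rat e"
      using * e0 unfolding infinitely_close_def by blast
    have "(of_rat (q - q') :: 'k) < of_rat (e + e)"
      using q(1) q'(1) unfolding of_rat_diff of_rat_add by linarith
    then have "q - q' < e + e" by (simp add: of_rat_less)
    then have "real_of_rat (q - q') < of_rat (e + e)" by (simp only: of_rat_less)
    then have "real_of_rat q - of_rat q' < of_rat e + of_rat e"
      by (simp only: of_rat_diff of_rat_add)
    moreover have "r < of_rat q + of_rat e" "of_rat q' - of_rat e < r'"
      using q(2) q'(2) by linarith+
    moreover have "real_of_rat e * 4 < r - r'"
      using e(2) by simp
    ultimately show False by linarith
  qed
  show "r = r'" if "infinitely_close k r" "infinitely_close k r'" for r r'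
    using le[of r r'] le[of r' r] that by simp
qed

subsection \<open>Weighted graphs\<close>

definition weighted_graph :: "'v set \<Rightarrow> ('v \<Rightarrow> 'v \<Rightarrow> 'k::linordered_field) \<Rightarrow> bool" where
  "weighted_graph V b \<longleftrightarrow>
     (\<forall>x\<in>V. \<forall>y\<in>V. b x y = b y x \<and> 0 \<le> b x y) \<and> (\<forall>x\<in>V. b x x = 0)"

definition neighbors :: "'v set \<Rightarrow> ('v \<Rightarrow> 'v \<Rightarrow> 'k::linordered_field) \<Rightarrow> 'v \<Rightarrow> 'v set" where
  "neighbors V b x = {y \<in> V. 0 < b x y}"

definition locally_finite :: "'v set \<Rightarrow> ('v \<Rightarrow> 'v \<Rightarrow> 'k::linordered_field) \<Rightarrow> bool" where
  "locally_finite V b \<longleftrightarrow> (\<forall>x\<in>V. finite (neighbors V b x))"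

text \<open>\<open>path_between V b x y xs\<close>: the nonempty vertex list \<open>xs\<close> is a path from \<open>x\<close> to \<open>y\<close> in \<open>V\<close>.\<close>

definition path_between ::
    "'v set \<Rightarrow> ('v \<Rightarrow> 'v \<Rightarrow> 'k::linordered_field) \<Rightarrow> 'v \<Rightarrow> 'v \<Rightarrow> 'v list \<Rightarrow> bool" where
  "path_between V b x y xs \<longleftrightarrow>
     xs \<noteq> [] \<and> set xs \<subseteq> V \<and> hd xs = x \<and> last xs = y \<and>
     (\<forall>i. Suc i < length xs \<longrightarrow> 0 < b (xs ! i) (xs ! Suc i))"

definition connected_on :: "'v set \<Rightarrow> ('v \<Rightarrow> 'v \<Rightarrow> 'k::linordered_field) \<Rightarrow> bool" where
  "connected_on K b \<longleftrightarrow> (\<forall>x\<in>K. \<forall>y\<in>K. \<exists>xs. path_between K b x y xs)"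

text \<open>
  \<open>b(x)\<close>. Sums over \<open>V\<close> are taken over the neighbors only: all other terms vanish, and
  \<open>sum\<close> over an infinite set is \<open>0\<close> by convention.
\<close>

definition vdegree :: "'v set \<Rightarrow> ('v \<Rightarrow> 'v \<Rightarrow> 'k::linordered_field) \<Rightarrow> 'v \<Rightarrow> 'k" where
  "vdegree V b x = (\<Sum>y\<in>neighbors V b x. b x y)"

definition trans_prob :: "'v set \<Rightarrow> ('v \<Rightarrow> 'v \<Rightarrow> 'k::linordered_field) \<Rightarrow> 'v \<Rightarrow> 'v \<Rightarrow> 'k" where
  "trans_prob V b x y = b x y / vdegree V b x"

definition real_trans :: "'v set \<Rightarrow> ('v \<Rightarrow> 'v \<Rightarrow> 'k::linordered_field) \<Rightarrow> 'v \<Rightarrow> 'v \<Rightarrow> real" where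
  "real_trans V b x y = real_part (trans_prob V b x y)"

subsection \<open>Markov chains and recurrence\<close>

text \<open>
  \<open>X\<close> is a Markov chain on \<open>V\<close> with transition matrix \<open>P\<close> started at \<open>x\<close>. The Markov property
  is multiplied out, so that no conditioning on null events occurs.
\<close>

definition markov_chain ::
    "'v set \<Rightarrow> ('v \<Rightarrow> 'v \<Rightarrow> real) \<Rightarrow> 'v \<Rightarrow> 'w measure \<Rightarrow> (nat \<Rightarrow> 'w \<Rightarrow> 'v) \<Rightarrow> bool" where
  "markov_chain V P x M X \<longleftrightarrow>
     prob_space M \<and> (\<forall>n. X n \<in> measurable M (count_space V)) \<and>
     measure M {\<omega> \<in> space M. X 0 \<omega> = x} = 1 \<and>
     (\<forall>n s. (\<forall>i. s i \<in> V) \<longrightarrow>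
        measure M {\<omega> \<in> space M. \<forall>i\<le>Suc n. X i \<omega> = s i} =
        measure M {\<omega> \<in> space M. \<forall>i\<le>n. X i \<omega> = s i} * P (s n) (s (Suc n)))"

text \<open>
  Realizations of the chain are taken on the sample space of vertex sequences. For a stochastic
  matrix a realization exists (lemma \<open>markov_chain_exists\<close> below), and the
  probability in question depends only on the law of the chain, so quantifying over all
  realizations amounts to taking any of them. On a one-point graph \<open>p(x,x) = 0/0\<close> evaluates to \<open>0\<close>,
  no realization exists, and the vertex counts as recurrent.
\<close>

definition recurrent_vertex :: "'v set \<Rightarrow> ('v \<Rightarrow> 'v \<Rightarrow> real) \<Rightarrow> 'v \<Rightarrow> bool" where
  "recurrent_vertex V P x \<longleftrightarrow>
     (\<forall>(M :: (nat \<Rightarrow> 'v) measure) X. markov_chain V P x M X \<longrightarrow>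
        measure M {\<omega> \<in> space M. infinite {n. X n \<omega> = x}} = 1)"

definition recurrent_set :: "'v set \<Rightarrow> ('v \<Rightarrow> 'v \<Rightarrow> real) \<Rightarrow> 'v set \<Rightarrow> bool" where
  "recurrent_set V P C \<longleftrightarrow> (\<forall>x\<in>C. recurrent_vertex V P x)"

definition transient_set :: "'v set \<Rightarrow> ('v \<Rightarrow> 'v \<Rightarrow> real) \<Rightarrow> 'v set \<Rightarrow> bool" where
  "transient_set V P C \<longleftrightarrow> (\<forall>x\<in>C. \<not> recurrent_vertex V P x)"

lemma markov_chain_exists:
  fixes P :: "'v \<Rightarrow> 'v \<Rightarrow> real"
  assumes V: "countable V" and x: "x \<in> V"
    and nonneg: "\<And>y z. y \<in> V \<Longrightarrow> z \<in> V \<Longrightarrow> 0 \<le> P y z"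
    and one: "\<And>y. y \<in> V \<Longrightarrow> (P y has_sum 1) V"
  shows "\<exists>(M :: (nat \<Rightarrow> 'v) measure) X. markov_chain V P x M X"
proof -
  define N where "N = (\<lambda>y. density (count_space V) (\<lambda>z. ennreal (P y z)))"
  define \<Omega> where "\<Omega> = PiM (UNIV \<times> V) (\<lambda>(_::nat, y). N y)"
  define Y where "Y = (\<lambda>(\<omega> :: nat \<times> 'v \<Rightarrow> 'v) n. rec_nat x (\<lambda>n y. \<omega> (n, y)) n)"
  have Y0 [simp]: "Y \<omega> 0 = x" and YS [simp]: "Y \<omega> (Suc n) = \<omega> (n, Y \<omega> n)" for \<omega> n
    by (simp_all add: Y_def)
  have N [simp]: "space (N y) = V" "sets (N y) = Pow V" for y
    by (simp_all add: N_def)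
  have prob_N: "prob_space (N y)" if y: "y \<in> V" for y
  proof
    have summable: "Infinite_Set_Sum.abs_summable_on (P y) V"
    proof -
      have "(\<lambda>z. norm (P y z)) summable_on V \<longleftrightarrow> P y summable_on V"
        by (intro summable_on_cong) (simp add: nonneg y)
      then show ?thesis
        using one[OF y] by (auto simp: abs_summable_equivalent[symmetric] summable_on_def)
    qed
    then have "(\<integral>\<^sup>+z. ennreal (P y z) \<partial>count_space V) = ennreal (infsetsum (P y) V)"
      by (intro nn_integral_conv_infsetsum) (auto simp: nonneg y)
    also have "infsetsum (P y) V = 1"
      using summable one[OF y]
      by (simp add: infsetsum_infsum infsumI)
    finally have int1: "(\<integral>\<^sup>+z. ennreal (P y z) \<partial>count_space V) = 1"
      by simp
    have "emeasure (N y) (space (N y)) = (\<integral>\<^sup>+z. ennreal (P y z) * indicator V z \<partial>count_space V)"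
      unfolding N(1) unfolding N_def by (rule emeasure_density) auto
    also have "\<dots> = (\<integral>\<^sup>+z. ennreal (P y z) \<partial>count_space V)"
      by (rule nn_integral_cong) simp
    finally show "emeasure (N y) (space (N y)) = 1"
      using int1 by simp
  qed
  have single_N: "emeasure (N y) {z} = ennreal (P y z)" if "z \<in> V" for y z
  proof -
    have "emeasure (N y) {z} = (\<integral>\<^sup>+w. ennreal (P y w) * indicator {z} w \<partial>count_space V)"
      using that by (simp add: N_def emeasure_density)
    also have "\<dots> = ennreal (P y z) * emeasure (count_space V) {z}"
      using that by (subst nn_integral_indicator_singleton) auto
    finally show ?thesis using that by simp
  qed
  have prob_\<Omega>: "prob_space \<Omega>"
    unfolding \<Omega>_def by (rule prob_space_PiM) (auto simp: prob_N)
  then interpret prob_space \<Omega> .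
  have coord: "(\<lambda>\<omega>. \<omega> (n, y)) \<in> measurable \<Omega> (count_space V)" if "y \<in> V" for n y
  proof -
    have "(\<lambda>\<omega>. \<omega> (n, y)) \<in> measurable \<Omega> (N y)"
      unfolding \<Omega>_def using that
      by (intro measurable_component_singleton[of "(n, y)" _ "\<lambda>(_, y). N y", simplified]) auto
    then show ?thesis
      by (simp cong: measurable_cong_sets add: measurable_cong_sets[of \<Omega> \<Omega> "N y" "count_space V"])
  qed
  have meas: "(\<lambda>\<omega>. Y \<omega> n) \<in> measurable \<Omega> (count_space V)" for n
  proof (induction n)
    case 0
    then show ?case using x by simp
  next
    case (Suc n)
    show ?case
      unfolding YS
      by (rule measurable_compose_countable'[where I = V and f = "\<lambda>y \<omega>. \<omega> (n, y)",
            OF coord Suc V])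
  qed
  have cyl: "measure \<Omega> {\<omega> \<in> space \<Omega>. \<forall>i\<le>n. Y \<omega> i = s i}
      = (if s 0 = x then \<Prod>i<n. P (s i) (s (Suc i)) else 0)"
    if s: "\<And>i. s i \<in> V" for s n
  proof (cases "s 0 = x")
    case True
    define J where "J = (\<lambda>i. (i, s i)) ` {..<n}"
    have eq: "(\<forall>i\<le>n. Y \<omega> i = s i) \<longleftrightarrow> (\<forall>i<n. \<omega> (i, s i) = s (Suc i))" for \<omega>
    proof (induction n)
      case 0
      then show ?case using True by simp
    next
      case (Suc n)
      have "(\<forall>i\<le>Suc n. Y \<omega> i = s i) \<longleftrightarrow> (\<forall>i\<le>n. Y \<omega> i = s i) \<and> Y \<omega> (Suc n) = s (Suc n)"
        by (auto simp: le_Suc_eq)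
      also have "\<dots> \<longleftrightarrow> (\<forall>i\<le>n. Y \<omega> i = s i) \<and> \<omega> (n, s n) = s (Suc n)"
        by auto
      finally show ?case using Suc by (auto simp: less_Suc_eq)
    qed
    have "{\<omega> \<in> space \<Omega>. \<forall>i\<le>n. Y \<omega> i = s i} =
        prod_emb (UNIV \<times> V) (\<lambda>(_, y). N y) J (PiE J (\<lambda>(i, y). {s (Suc i)}))"
      unfolding eq by (auto simp: \<Omega>_def prod_emb_def space_PiM J_def PiE_iff extensional_def)
    then have "emeasure \<Omega> {\<omega> \<in> space \<Omega>. \<forall>i\<le>n. Y \<omega> i = s i} =
        emeasure \<Omega> (prod_emb (UNIV \<times> V) (\<lambda>(_, y). N y) J (PiE J (\<lambda>(i, y). {s (Suc i)})))"
      by simp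
    also have "\<dots> = (\<Prod>j\<in>J. emeasure (case j of (_, y) \<Rightarrow> N y) (case j of (i, y) \<Rightarrow> {s (Suc i)}))"
      unfolding \<Omega>_def
      by (rule emeasure_PiM_emb) (auto simp: prob_N J_def s)
    also have "\<dots> = (\<Prod>i<n. ennreal (P (s i) (s (Suc i))))"
      unfolding J_def by (subst prod.reindex) (auto simp: inj_on_def single_N s)
    also have "\<dots> = ennreal (\<Prod>i<n. P (s i) (s (Suc i)))"
      by (rule prod_ennreal) (simp add: nonneg s)
    finally show ?thesis
      using True by (simp add: measure_def prod_nonneg nonneg s)
  next
    case False
    then have "{\<omega> \<in> space \<Omega>. \<forall>i\<le>n. Y \<omega> i = s i} = {}" by auto
    then show ?thesis using False by (simp only: measure_empty if_False)
  qed
  define M where "M = distr \<Omega> (PiM UNIV (\<lambda>_. count_space V)) Y"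
  have Y: "Y \<in> measurable \<Omega> (PiM UNIV (\<lambda>_. count_space V))"
    by (rule measurable_PiM_single') (use meas measurable_space[OF meas] in auto)
  have *: "measure M {\<omega> \<in> space M. \<forall>i\<in>I. \<omega> i = s i}
      = measure \<Omega> {\<omega> \<in> space \<Omega>. \<forall>i\<in>I. Y \<omega> i = s i}" if "\<And>i. s i \<in> V" "finite I" for s I
  proof -
    have "{\<omega> \<in> space (PiM UNIV (\<lambda>_. count_space V)). \<forall>i\<in>I. \<omega> i = s i}
        \<in> sets (PiM UNIV (\<lambda>_. count_space V))"
      using that by measurable
    then show ?thesis
      unfolding M_def using measurable_space[OF Y]
      by (subst measure_distr[OF Y]) (auto intro!: arg_cong[of _ _ "measure \<Omega>"])
  qed
  have "markov_chain V P x M (\<lambda>n \<omega>. \<omega> n)"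
    unfolding markov_chain_def
  proof (intro conjI allI impI)
    show "prob_space M" unfolding M_def by (rule prob_space_distr[OF Y])
    show "(\<lambda>\<omega>. \<omega> n) \<in> measurable M (count_space V)" for n
      unfolding M_def by simp
    show "measure M {\<omega> \<in> space M. \<omega> 0 = x} = 1"
      using *[of "\<lambda>_. x" "{0}"] x by (simp add: prob_space)
    fix n and s :: "nat \<Rightarrow> 'v"
    assume s: "\<forall>i. s i \<in> V"
    have "measure M {\<omega> \<in> space M. \<forall>i\<le>m. \<omega> i = s i} =
        (if s 0 = x then \<Prod>i<m. P (s i) (s (Suc i)) else 0)" for m
      using *[of s "{..m}"] cyl[of s m] s by (simp only: Ball_def atMost_iff finite_atMost)
    then show "measure M {\<omega> \<in> space M. \<forall>i\<le>Suc n. \<omega> i = s i} =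
        measure M {\<omega> \<in> space M. \<forall>i\<le>n. \<omega> i = s i} * P (s n) (s (Suc n))"
      by (simp only: prod.lessThan_Suc) simp
  qed
  then show ?thesis by blast
qed

subsection \<open>Strongly connected components\<close>

definition strongly_linked ::
    "'v set \<Rightarrow> ('v \<Rightarrow> 'v \<Rightarrow> 'k::linordered_field) \<Rightarrow> 'v \<Rightarrow> 'v \<Rightarrow> bool" where
  "strongly_linked V b x y \<longleftrightarrow>
     (\<exists>xs. path_between V b x y xs \<and>
        (\<forall>i. Suc i < length xs \<longrightarrow>
           comparable (vdegree V b x) (b (xs ! i) (xs ! Suc i)) \<and>
           comparable (b (xs ! i) (xs ! Suc i)) (vdegree V b y)))"

definition strongly_connected_component ::
    "'v set \<Rightarrow> ('v \<Rightarrow> 'v \<Rightarrow> 'k::linordered_field) \<Rightarrow> 'v set \<Rightarrow> bool" where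
  "strongly_connected_component V b C \<longleftrightarrow>
     C \<subseteq> V \<and> (\<forall>x\<in>C. \<forall>y\<in>C. strongly_linked V b x y) \<and>
     (\<forall>D. C \<subseteq> D \<and> D \<subseteq> V \<and> (\<forall>x\<in>D. \<forall>y\<in>D. strongly_linked V b x y) \<longrightarrow> D = C)"

text \<open>
  \<open>comparable\<close> includes positivity, which fails for \<open>b(x) = 0\<close> on a one-point graph. The
  disjunct \<open>x = y\<close> makes the trivially satisfied condition \<open>b(x) \<simeq> b(x)\<close> hold there as well; it
  changes nothing when \<open>V\<close> has at least two elements.
\<close>

definition essential ::
    "'v set \<Rightarrow> ('v \<Rightarrow> 'v \<Rightarrow> 'k::linordered_field) \<Rightarrow> 'v set \<Rightarrow> bool" where
  "essential V b C \<longleftrightarrow>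
     (\<forall>x\<in>C. \<forall>y xs. path_between V b x y xs \<and>
        (\<forall>i. Suc i < length xs \<longrightarrow> comparable (b (xs ! i) (xs ! Suc i)) (vdegree V b (xs ! i)))
        \<longrightarrow> x = y \<or> comparable (vdegree V b x) (vdegree V b y))"

subsection \<open>Capacity\<close>

definition laplacian ::
    "'v set \<Rightarrow> ('v \<Rightarrow> 'v \<Rightarrow> 'k::linordered_field) \<Rightarrow> ('v \<Rightarrow> 'k) \<Rightarrow> 'v \<Rightarrow> 'k" where
  "laplacian V b f x = 1 / vdegree V b x * (\<Sum>y\<in>neighbors V b x. b x y * (f x - f y))"

text \<open>\<open>v\<close> is required to vanish also outside \<open>V\<close>, to make it unique as a total function.\<close>

definition potential ::
    "'v set \<Rightarrow> ('v \<Rightarrow> 'v \<Rightarrow> 'k::linordered_field) \<Rightarrow> 'v set \<Rightarrow> 'v \<Rightarrow> 'v \<Rightarrow> 'k" where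
  "potential V b K a =
     (THE v. (\<forall>x\<in>K - {a}. laplacian V b v x = 0) \<and> v a = 1 \<and> (\<forall>x. x \<notin> K \<longrightarrow> v x = 0))"

definition capacity ::
    "'v set \<Rightarrow> ('v \<Rightarrow> 'v \<Rightarrow> 'k::linordered_field) \<Rightarrow> 'v set \<Rightarrow> 'v \<Rightarrow> 'k" where
  "capacity V b K a = vdegree V b a * laplacian V b (potential V b K a) a"

text \<open>In \<open>ereal\<close>, \<open>1 / 0 = \<infinity>\<close>.\<close>

definition green ::
    "'v set \<Rightarrow> ('v \<Rightarrow> 'v \<Rightarrow> 'k::linordered_field) \<Rightarrow> 'v set \<Rightarrow> 'v \<Rightarrow> ereal" where
  "green V b K a = 1 / ereal (real_part (capacity V b K a / vdegree V b a))"

definition exhaustion ::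
    "'v set \<Rightarrow> ('v \<Rightarrow> 'v \<Rightarrow> 'k::linordered_field) \<Rightarrow> (nat \<Rightarrow> 'v set) \<Rightarrow> bool" where
  "exhaustion V b K \<longleftrightarrow>
     incseq K \<and> (\<forall>n. finite (K n) \<and> connected_on (K n) b) \<and> (\<Union>n. K n) = V"

definition green_limit ::
    "'v set \<Rightarrow> ('v \<Rightarrow> 'v \<Rightarrow> 'k::linordered_field) \<Rightarrow> (nat \<Rightarrow> 'v set) \<Rightarrow> 'v \<Rightarrow> ereal" where
  "green_limit V b K a = limsup (\<lambda>n. green V b (K n) a)"

end

theory Submission
  imports Defs
begin

text \<open>
  Up to \<open>\<simeq>\<close>, the degree \<open>b(x)\<close> cannot decrease along transitions of positive real probability,
  since there \<open>b(x) \<simeq> b(x,y) \<le> b(y)\<close>. Hence from a non-essential component the real chain reaches,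
  with positive probability, vertices of much larger degree, from which it never returns. An
  essential component is closed and irreducible for the real chain. There the last-visit
  decomposition shows that \<open>a\<close> is recurrent iff the probability of never returning to \<open>a\<close> is \<open>0\<close>.
  The real part of \<open>1 - v\<close>, with \<open>v\<close> the potential on \<open>K\<close>, solves the Dirichlet problem of the
  real chain on \<open>K \<inter> C\<close>, whose solution is unique because \<open>a\<close> can be reached from everywhere in
  \<open>C\<close>. So \<open>\<rho>(cap\<^sub>K(a)/b(a))\<close> is the probability of leaving \<open>K\<close> before returning to \<open>a\<close>, which
  converges along an exhaustion to the probability of never returning.
\<close>

subsection \<open>Real parts\<close>

text \<open>The field need be neither Archimedean nor complete, so the potentials of growing sets K
  need not converge in it. The real part is therefore taken for each finite K, where it commutes
  with the finite sums of the Laplacian, and limits are formed in the reals only. The price is that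
  infinitesimal transition probabilities become 0. Connectedness of K gives uniqueness of the
  Dirichlet problem over the field, but a path in K may use edges that the real chain never takes,
  so the real problem on K can have many solutions; this forces the restriction to K \<inter> C. For
  the same reason strong links, being paths of the graph, need not be paths of the real chain.
  Instead of hitting times, the proof works with the numbers \<open>avoid\<close> and
  \<open>escape\<close>, computed from the matrix by recursion and limit, and compares them with the
  potentials by a maximum principle.\<close>

lemma infinitely_close_bounded:
  assumes "infinitely_close k r"
  shows "\<exists>c. \<bar>k\<bar> < of_rat c \<and> \<bar>r\<bar> < of_rat c"
proof -
  obtain q where q: "\<bar>k - of_rat q\<bar> < of_rat 1" "\<bar>r - of_rat q\<bar> < of_rat 1"
    using assms unfolding infinitely_close_def by (meson zero_less_one)
  \<comment> \<open>The estimate is proved for an arbitrary ordered field and then used both in 'k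
    and in the reals; the same device serves for sums and products.\<close>
  have *: "\<bar>x\<bar> < of_rat (\<bar>q\<bar> + 1)" if "\<bar>x - of_rat q\<bar> < of_rat 1" for x :: "'b::linordered_field"
  proof -
    have "\<bar>x\<bar> \<le> \<bar>x - of_rat q\<bar> + \<bar>of_rat q\<bar>"
      using abs_triangle_ineq[of "x - of_rat q" "of_rat q"] by simp
    also have "\<dots> < 1 + \<bar>of_rat q\<bar>" using that by simp
    also have "\<bar>of_rat q :: 'b\<bar> = of_rat \<bar>q\<bar>"
      by (cases "q \<ge> 0") (auto simp: abs_if of_rat_minus)
    finally show ?thesis by (simp add: of_rat_add)
  qed
  show ?thesis using *[OF q(1)] *[OF q(2)] by (intro exI conjI)
qed

lemma real_part_eqI:
  assumes "infinitely_close k r"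
  shows "real_part k = r"
  unfolding real_part_def
  using infinitely_close_bounded[OF assms] infinitely_close_unique_ex assms
  by (metis the1_equality)

lemma infinitely_close_real_part:
  assumes "\<bar>k\<bar> < of_rat c"
  shows "infinitely_close k (real_part k)"
  unfolding real_part_def by (rule theI'[OF infinitely_close_unique_ex[OF assms]])

lemma infinitely_close_of_rat: "infinitely_close (of_rat q) (of_rat q)"
  unfolding infinitely_close_def by (intro allI impI exI[of _ q]) simp

lemma infinitely_close_0: "infinitely_close 0 0"
  and infinitely_close_1: "infinitely_close 1 1"
  using infinitely_close_of_rat[of 0] infinitely_close_of_rat[of 1] by simp_all

lemma infinitely_close_add:
  assumes "infinitely_close k r" "infinitely_close l s"
  shows "infinitely_close (k + l) (r + s)"
  unfolding infinitely_close_def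
proof (intro allI impI)
  fix e :: rat
  assume "0 < e"
  then have e: "0 < e / 2" by simp
  obtain q where q: "\<bar>k - of_rat q\<bar> < of_rat (e / 2)" "\<bar>r - of_rat q\<bar> < of_rat (e / 2)"
    using assms(1) e unfolding infinitely_close_def by meson
  obtain t where t: "\<bar>l - of_rat t\<bar> < of_rat (e / 2)" "\<bar>s - of_rat t\<bar> < of_rat (e / 2)"
    using assms(2) e unfolding infinitely_close_def by meson
  have *: "\<bar>x + y - of_rat (q + t)\<bar> < of_rat e"
    if "\<bar>x - of_rat q\<bar> < of_rat (e / 2)" "\<bar>y - of_rat t\<bar> < of_rat (e / 2)"
    for x y :: "'b::linordered_field"
  proof -
    have *: "\<bar>x + y - of_rat (q + t)\<bar> \<le> \<bar>x - of_rat q\<bar> + \<bar>y - of_rat t\<bar>"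
      using abs_triangle_ineq[of "x - of_rat q" "y - of_rat t"]
      by (simp add: of_rat_add algebra_simps)
    also have "\<dots> < of_rat (e / 2) + of_rat (e / 2)" using that by simp
    also have "\<dots> = of_rat e" by (simp flip: of_rat_add)
    finally show ?thesis .
  qed
  show "\<exists>q. \<bar>k + l - of_rat q\<bar> < of_rat e \<and> \<bar>r + s - of_rat q\<bar> < of_rat e"
    using *[OF q(1) t(1)] *[OF q(2) t(2)] by (intro exI conjI)
qed

lemma infinitely_close_mult:
  assumes "infinitely_close k r" "infinitely_close l s"
  shows "infinitely_close (k * l) (r * s)"
  unfolding infinitely_close_def
proof (intro allI impI)
  fix e :: rat
  assume e: "0 < e"
  obtain c1 where c1: "\<bar>k\<bar> < of_rat c1" "\<bar>r\<bar> < of_rat c1"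
    using infinitely_close_bounded[OF assms(1)] by blast
  obtain c2 where c2: "\<bar>l\<bar> < of_rat c2" "\<bar>s\<bar> < of_rat c2"
    using infinitely_close_bounded[OF assms(2)] by blast
  have pos: "0 < real_of_rat c1" "0 < real_of_rat c2" using c1 c2 by linarith+
  \<comment> \<open>\<open>B\<close> exceeds \<bar>x\<bar> and \<bar>t\<bar>, since
    \<open>d \<le> 1\<close> bounds the latter by \<open>c2 + 1\<close>. Both parts of x (y - t) + t
    (x - q) are then at most B d \<le> e / 2.\<close>
  define B where "B = c1 + c2 + 1"
  define d where "d = min 1 (e / (2 * B))"
  have B: "0 < B" "c1 < B" "c2 + 1 < B" using pos by (auto simp: B_def)
  have d: "0 < d" "d \<le> 1" using e B by (auto simp: d_def)
  have "d \<le> e / (2 * B)" by (simp add: d_def)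
  then have dB: "B * d + B * d \<le> e" using B by (simp add: field_simps)
  obtain q where q: "\<bar>k - of_rat q\<bar> < of_rat d" "\<bar>r - of_rat q\<bar> < of_rat d"
    using assms(1) d unfolding infinitely_close_def by meson
  obtain t where t: "\<bar>l - of_rat t\<bar> < of_rat d" "\<bar>s - of_rat t\<bar> < of_rat d"
    using assms(2) d unfolding infinitely_close_def by meson
  have *: "\<bar>x * y - of_rat (q * t)\<bar> < of_rat e"
    if x: "\<bar>x - of_rat q\<bar> < of_rat d" "\<bar>x\<bar> < of_rat c1"
      and y: "\<bar>y - of_rat t\<bar> < of_rat d" "\<bar>y\<bar> < of_rat c2"
    for x y :: "'b::linordered_field"
  proof -
    have B': "0 < (of_rat B :: 'b)" "(of_rat c1 :: 'b) < of_rat B" "(of_rat (c2 + 1) :: 'b) < of_rat B"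
      using B by (simp_all add: of_rat_less)
    have "(of_rat d :: 'b) \<le> 1" using d of_rat_less_eq[of d 1] by (metis of_rat_1)
    moreover have "\<bar>of_rat t\<bar> \<le> \<bar>y - of_rat t\<bar> + \<bar>y\<bar>"
      using abs_triangle_ineq[of "of_rat t - y" y] by (simp add: abs_minus_commute)
    ultimately have "\<bar>of_rat t :: 'b\<bar> < of_rat B" using y B'(3) unfolding of_rat_add of_rat_1 by linarith
    then have t': "\<bar>of_rat t\<bar> * \<bar>x - of_rat q\<bar> \<le> of_rat B * of_rat d"
      using x B(1) by (intro mult_mono) (auto intro: less_imp_le)
    have "\<bar>x\<bar> * \<bar>y - of_rat t\<bar> \<le> of_rat B * \<bar>y - of_rat t\<bar>"
      using x B' by (intro mult_right_mono) auto
    also have "\<dots> < of_rat B * of_rat d" using y B' by simp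
    finally have x': "\<bar>x\<bar> * \<bar>y - of_rat t\<bar> < of_rat B * of_rat d" .
    have "\<bar>x * y - of_rat (q * t)\<bar> = \<bar>x * (y - of_rat t) + of_rat t * (x - of_rat q)\<bar>"
      by (simp add: of_rat_mult algebra_simps)
    also have "\<dots> \<le> \<bar>x\<bar> * \<bar>y - of_rat t\<bar> + \<bar>of_rat t\<bar> * \<bar>x - of_rat q\<bar>"
      using abs_triangle_ineq by (metis abs_mult)
    also have "\<dots> < of_rat (B * d + B * d)"
      using t' x' by (simp add: of_rat_add of_rat_mult)
    also have "\<dots> \<le> of_rat e" using dB by (simp only: of_rat_less_eq)
    finally show ?thesis .
  qed
  show "\<exists>q. \<bar>k * l - of_rat q\<bar> < of_rat e \<and> \<bar>r * s - of_rat q\<bar> < of_rat e"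
    using *[OF q(1) c1(1) t(1) c2(1)] *[OF q(2) c1(2) t(2) c2(2)] by (intro exI conjI)
qed

lemma infinitely_close_sum:
  assumes "\<And>i. i \<in> I \<Longrightarrow> infinitely_close (f i) (g i)"
  shows "infinitely_close (sum f I) (sum g I)"
  using assms
  by (induction I rule: infinite_finite_induct)
     (auto intro: infinitely_close_add infinitely_close_0)

lemma infinitely_close_diff:
  assumes "infinitely_close k r" "infinitely_close l s"
  shows "infinitely_close (k - l) (r - s)"
  using infinitely_close_add[OF assms(1) infinitely_close_mult[OF infinitely_close_of_rat[of "-1"] assms(2)]]
  by (simp add: of_rat_minus)

lemma infinitely_close_nonneg:
  assumes "infinitely_close k r" "0 \<le> k"
  shows "0 \<le> r"
proof (rule ccontr)
  assume "\<not> 0 \<le> r"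
  then obtain e where e: "0 < real_of_rat e" "real_of_rat e < - r / 2"
    using of_rat_dense[of 0 "- r / 2"] by auto
  then obtain q where q: "\<bar>k - of_rat q\<bar> < of_rat e" "\<bar>r - of_rat q\<bar> < of_rat e"
    using assms(1) unfolding infinitely_close_def by auto
  have "real_of_rat q < of_rat (- e)" using q(2) e(2) by (simp add: of_rat_minus)
  then have "q < - e" by (simp only: of_rat_less)
  then have "(of_rat q :: 'a) < of_rat (- e)" by (simp only: of_rat_less)
  with q(1) assms(2) show False by (simp add: of_rat_minus)
qed

text \<open>Positive infinitesimals have real part 0, so positivity in the reals amounts to a
  positive rational lower bound in the field. This is what ties the transitions of the real chain to
  \<open>comparable\<close>.\<close>

lemma infinitely_close_pos_iff:
  assumes "infinitely_close k r" 
  shows "0 < r \<longleftrightarrow> (\<exists>c>0. of_rat c < k)"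
proof
  assume "0 < r"
  \<comment> \<open>The bound \<open>r / 3\<close> leaves room for two errors: q > r - c > 2 c, and
    hence k > q - c > c.\<close>
  then obtain c where c: "0 < real_of_rat c" "real_of_rat c < r / 3"
    using of_rat_dense[of 0 "r / 3"] by auto
  then obtain q where q: "\<bar>k - of_rat q\<bar> < of_rat c" "\<bar>r - of_rat q\<bar> < of_rat c"
    using assms unfolding infinitely_close_def by auto
  have "real_of_rat (c + c) < of_rat q" using q(2) c(2) unfolding of_rat_add by linarith
  then have "c + c < q" by (simp only: of_rat_less)
  then have "(of_rat (c + c) :: 'a) < of_rat q" by (simp only: of_rat_less)
  then have "of_rat c < k" using q(1) unfolding of_rat_add by linarith
  then show "\<exists>c>0. of_rat c < k" using c by auto
next
  assume "\<exists>c>0. of_rat c < k"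
  then obtain c where c: "0 < c" "of_rat c < k" by blast
  then have "0 \<le> r - of_rat c"
    using infinitely_close_nonneg[OF infinitely_close_diff[OF assms infinitely_close_of_rat[of c]]]
    by simp
  then show "0 < r" using c(1) by (smt (verit) zero_less_of_rat_iff)
qed

lemma infinitely_close_real_part_unit:
  fixes k :: "'k::linordered_field"
  assumes "0 \<le> k" "k \<le> 1"
  shows "infinitely_close k (real_part k)"
proof (rule infinitely_close_real_part)
  have "\<bar>k\<bar> \<le> 1" using assms by (simp only: abs_of_nonneg)
  also have "(1 :: 'k) < of_rat 2" by simp
  finally show "\<bar>k\<bar> < of_rat 2" .
qed

lemma real_part_unit_bounds:
  assumes "0 \<le> k" "k \<le> 1"
  shows "0 \<le> real_part k" "real_part k \<le> 1"
proof -
  note close = infinitely_close_real_part_unit[OF assms]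
  show "0 \<le> real_part k" using infinitely_close_nonneg[OF close assms(1)] .
  have "0 \<le> 1 - k" using assms(2) by simp
  with infinitely_close_nonneg[OF infinitely_close_diff[OF infinitely_close_1 close]]
  have "0 \<le> 1 - real_part k" .
  then show "real_part k \<le> 1" by simp
qed

subsection \<open>Markov chains with finite transition ranges\<close>

text \<open>A positive maximum over \<open>D\<close> spreads along every positive weight and cannot
  cross the boundary, where the values are at most 0; so it would never leave \<open>D\<close>,
  against the exit assumption. The weights are unnormalised and the field is arbitrary because the
  principle is applied both to \<open>b\<close> and to the real transition probabilities. Boundary
  values are constrained only where a positive weight leads, since for the real chain nothing is
  known elsewhere.\<close>

lemma discrete_maximum_principle:
  fixes p :: "'v \<Rightarrow> 'v \<Rightarrow> 'k::linordered_field" and u :: "'v \<Rightarrow> 'k"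
  assumes D: "finite D"
    and N: "\<And>y. y \<in> D \<Longrightarrow> finite (N y)"
    and nonneg: "\<And>y z. y \<in> D \<Longrightarrow> z \<in> N y \<Longrightarrow> 0 \<le> p y z"
    and subharmonic: "\<And>y. y \<in> D \<Longrightarrow> 0 \<le> (\<Sum>z\<in>N y. p y z * (u z - u y))"
    and exit: "\<And>y. y \<in> D \<Longrightarrow> \<exists>z. z \<notin> D \<and> (y, z) \<in> {(y, z). z \<in> N y \<and> 0 < p y z}\<^sup>*"
    and boundary: "\<And>y z. y \<in> D \<Longrightarrow> z \<in> N y \<Longrightarrow> 0 < p y z \<Longrightarrow> z \<notin> D \<Longrightarrow> u z \<le> 0"
    and y: "y \<in> D"
  shows "u y \<le> 0"
proof (rule ccontr)
  assume "\<not> u y \<le> 0"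
  have "finite (u ` D)" "u ` D \<noteq> {}" using D y by auto
  then have "Max (u ` D) \<in> u ` D" "u y \<le> Max (u ` D)" using y by (auto intro: Max_ge)
  then obtain w where w: "w \<in> D" "u w = Max (u ` D)" by auto
  have M: "0 < u w" using \<open>\<not> u y \<le> 0\<close> \<open>u y \<le> Max (u ` D)\<close> w by auto
  have le: "u z \<le> u w" if "z \<in> D" for z using D w that by (auto intro: Max_ge)
  have propagate: "z \<in> D \<and> u z = u w" if t: "t \<in> D" "u t = u w" and z: "z \<in> N t" "0 < p t z" for t z
  proof -
    have nonpos: "p t z' * (u z' - u t) \<le> 0" if "z' \<in> N t" for z'
    proof (cases "0 < p t z'")
      case True
      then have "u z' \<le> u w"
        using le[of z'] boundary[OF t(1) that True] M by linarith
      then show ?thesis using t nonneg[OF t(1) that] by (intro mult_nonneg_nonpos) auto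
    next
      case False
      then show ?thesis using nonneg[OF t(1) that] by simp
    qed
    then have "(\<Sum>z\<in>N t. p t z * (u z - u t)) \<le> 0" by (rule sum_nonpos)
    then have "(\<Sum>z\<in>N t. p t z * (u z - u t)) = 0" using subharmonic[OF t(1)] by simp
    then have "(\<Sum>z\<in>N t. - (p t z * (u z - u t))) = 0" by (simp add: sum_negf)
    then have "- (p t z * (u z - u t)) = 0"
      by (rule sum_nonneg_0[OF N[OF t(1)], rotated]) (use nonpos z in auto)
    then have "u z = u w" using z t by simp
    then show ?thesis using boundary[OF t(1) z] M by fastforce
  qed
  have "z \<in> D \<and> u z = u w" if "(w, z) \<in> {(y, z). z \<in> N y \<and> 0 < p y z}\<^sup>*" for z
    using that
  proof induction
    case (step t z)
    then show ?case using propagate[of t z] by simp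
  qed (use w in simp)
  then show False using exit[OF w(1)] by blast
qed

section \<open>Avoidance and escape probabilities of a transition matrix\<close>

locale markov_kernel =
  fixes V :: "'v set" and P :: "'v \<Rightarrow> 'v \<Rightarrow> real" and N :: "'v \<Rightarrow> 'v set"
  assumes countable_V: "countable V"
    and finite_N: "\<And>y. y \<in> V \<Longrightarrow> finite (N y)"
    and N_subset: "\<And>y. y \<in> V \<Longrightarrow> N y \<subseteq> V"
    and nonneg: "\<And>y z. y \<in> V \<Longrightarrow> z \<in> V \<Longrightarrow> 0 \<le> P y z"
    and outside_N: "\<And>y z. y \<in> V \<Longrightarrow> z \<in> V \<Longrightarrow> z \<notin> N y \<Longrightarrow> P y z = 0"
    and sum_N: "\<And>y. y \<in> V \<Longrightarrow> (\<Sum>z\<in>N y. P y z) = 1"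
begin

text \<open>\<open>N y\<close> only has to contain the support of \<open>P y\<close>: graph
  neighbors of infinitesimal probability belong to it with real probability 0. The strict inequality
  sorts them out.\<close>

definition edges :: "('v \<times> 'v) set" where
  "edges = {(y, z). y \<in> V \<and> z \<in> N y \<and> 0 < P y z}"

text \<open>\<open>avoid a n y\<close> is the probability that the chain started at \<open>y\<close> is not in \<open>a\<close> at the
  times \<open>1, \<dots>, n\<close>; time \<open>0\<close> is exempt.\<close>

primrec avoid :: "'v \<Rightarrow> nat \<Rightarrow> 'v \<Rightarrow> real" where
  "avoid a 0 y = 1"
| "avoid a (Suc n) y = (\<Sum>z\<in>N y - {a}. P y z * avoid a n z)"

text \<open>The probability that the chain started at \<open>y\<close> is at \<open>a\<close> at no
  positive time; for \<open>y = a\<close>, the probability of never returning.\<close>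

definition escape :: "'v \<Rightarrow> 'v \<Rightarrow> real" where
  "escape a y = lim (\<lambda>n. avoid a n y)"

lemma N_in_V: "y \<in> V \<Longrightarrow> z \<in> N y \<Longrightarrow> z \<in> V"
  using N_subset by blast

lemma nonneg_N: "y \<in> V \<Longrightarrow> z \<in> N y \<Longrightarrow> 0 \<le> P y z"
  using nonneg N_in_V by blast

lemma avoid_nonneg: "y \<in> V \<Longrightarrow> 0 \<le> avoid a n y"
proof (induction n arbitrary: y)
  case (Suc n)
  show ?case
    unfolding avoid.simps
  proof (intro sum_nonneg mult_nonneg_nonneg)
    fix z
    assume "z \<in> N y - {a}"
    then show "0 \<le> P y z" "0 \<le> avoid a n z"
      using nonneg_N[OF Suc.prems] Suc.IH N_in_V[OF Suc.prems] by auto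
  qed
qed simp

lemma avoid_Suc_le: "y \<in> V \<Longrightarrow> avoid a (Suc n) y \<le> avoid a n y"
proof (induction n arbitrary: y)
  case 0
  have "(\<Sum>z\<in>N y - {a}. P y z) \<le> (\<Sum>z\<in>N y. P y z)"
    using 0 by (intro sum_mono2) (auto simp: finite_N nonneg_N)
  then show ?case using sum_N 0 by simp
next
  case (Suc n)
  show ?case
    unfolding avoid.simps(2)[of a "Suc n"] avoid.simps(2)[of a n y]
    using Suc.prems N_in_V[OF Suc.prems]
    by (intro sum_mono mult_left_mono Suc.IH) (auto intro: nonneg_N)
qed

lemma avoid_decseq: "y \<in> V \<Longrightarrow> decseq (\<lambda>n. avoid a n y)"
  by (intro decseq_SucI avoid_Suc_le)

lemma avoid_tendsto: "y \<in> V \<Longrightarrow> (\<lambda>n. avoid a n y) \<longlonglongrightarrow> escape a y"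
  unfolding escape_def convergent_LIMSEQ_iff[symmetric]
  by (rule decseq_convergent[OF avoid_decseq, of y 0 a])
     (auto intro: avoid_nonneg simp: convergent_def)

lemma escape_le_avoid: "y \<in> V \<Longrightarrow> escape a y \<le> avoid a n y"
  by (rule decseq_ge[OF avoid_decseq avoid_tendsto])

lemma escape_nonneg: "y \<in> V \<Longrightarrow> 0 \<le> escape a y"
  by (rule LIMSEQ_le_const[OF avoid_tendsto]) (auto intro: avoid_nonneg)

lemma escape_le_1: "y \<in> V \<Longrightarrow> escape a y \<le> 1"
  using escape_le_avoid[of y a 0] by simp

lemma escape_eq:
  assumes y: "y \<in> V"
  shows "escape a y = (\<Sum>z\<in>N y - {a}. P y z * escape a z)"
proof (rule LIMSEQ_unique)
  show "(\<lambda>n. avoid a (Suc n) y) \<longlonglongrightarrow> escape a y"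
    using avoid_tendsto[OF y] by (rule LIMSEQ_Suc)
  show "(\<lambda>n. avoid a (Suc n) y) \<longlonglongrightarrow> (\<Sum>z\<in>N y - {a}. P y z * escape a z)"
    unfolding avoid.simps using N_in_V[OF y]
    by (intro tendsto_sum tendsto_mult tendsto_const avoid_tendsto) auto
qed

lemma edges_rtrancl_in_V: "(y, z) \<in> edges\<^sup>* \<Longrightarrow> y \<in> V \<Longrightarrow> z \<in> V"
  by (induction rule: rtrancl_induct) (auto simp: edges_def N_in_V)

text \<open>The one-step equation for \<open>escape\<close> has nonnegative terms, so a zero spreads
  to every successor of positive probability. The term of \<open>a\<close> is missing from that
  equation, but there the value is 0 by assumption.\<close>

lemma escape_eq_0_reachable:
  assumes a: "a \<in> V" "escape a a = 0" and z: "(a, z) \<in> edges\<^sup>*"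
  shows "escape a z = 0"
  using z
proof induction
  case base
  then show ?case using a by simp
next
  case (step y z)
  then have y: "y \<in> V" "z \<in> N y" "0 < P y z" by (auto simp: edges_def)
  show ?case
  proof (cases "z = a")
    case False
    have "(\<Sum>z\<in>N y - {a}. P y z * escape a z) = 0" using step escape_eq[OF y(1), of a] by simp
    then have "P y z * escape a z = 0"
      by (rule sum_nonneg_0[rotated 2])
         (use y False N_in_V[OF y(1)] in \<open>auto simp: finite_N nonneg_N escape_nonneg\<close>)
    then show ?thesis using y by simp
  qed (use a in simp)
qed

lemma escape_not_reachable:
  assumes y: "y \<in> V" and ya: "(y, a) \<notin> edges\<^sup>*"
  shows "escape a y = 1"
proof -
  have "avoid a n z = 1" if "(y, z) \<in> edges\<^sup>*" for n z
    using that
  proof (induction n arbitrary: z)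
    case (Suc n)
    have z: "z \<in> V" using edges_rtrancl_in_V Suc y by blast
    have "P z t * avoid a n t = P z t" if t: "t \<in> N z" for t
    proof (cases "0 < P z t")
      case True
      then have "(y, t) \<in> edges\<^sup>*" using Suc.prems t z by (auto simp: edges_def intro: rtrancl_into_rtrancl)
      then show ?thesis using Suc.IH by simp
    next
      case False
      then show ?thesis using nonneg_N[OF z t] by simp
    qed
    then have "avoid a (Suc n) z = (\<Sum>t\<in>N z - {a}. P z t)"
      unfolding avoid.simps by (intro sum.cong) auto
    also have "\<dots> = (\<Sum>t\<in>N z. P z t)"
    proof (cases "a \<in> N z")
      case True
      have "(z, a) \<notin> edges" using Suc.prems ya by (meson rtrancl_into_rtrancl)
      then have "P z a = 0" using True z nonneg_N[OF z True] by (auto simp: edges_def)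
      then show ?thesis using True finite_N[OF z] by (simp add: sum_diff1)
    qed simp
    finally show ?case using sum_N[OF z] by simp
  qed simp
  from this[OF rtrancl_refl] show ?thesis by (simp add: escape_def lim_def)
qed

text \<open>From a recurrent \<open>x\<close>, the probability of never reaching \<open>y\<close> is subharmonic and maximal at
  \<open>x\<close>, hence constant, and it vanishes at \<open>y\<close>.\<close>

lemma escape_eq_0_transfer:
  assumes x: "x \<in> V" "escape x x = 0" and xy: "(x, y) \<in> edges\<^sup>*"
  shows "escape y y = 0"
proof -
  have y: "y \<in> V" using edges_rtrancl_in_V x xy by blast
  \<comment> \<open>\<open>escape\<close> exempts time 0. Resetting the value at \<open>y\<close> to
    0 counts time 0 as well and turns the harmonic equation into a subharmonic inequality.\<close>
  define w where "w z = (if z = y then 0 else escape y z)" for z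
  have w: "0 \<le> w z" "w z \<le> 1" if "z \<in> V" for z
    using that by (auto simp: w_def escape_nonneg escape_le_1)
  have eq: "escape y z = (\<Sum>t\<in>N z. P z t * w t)" if "z \<in> V" for z
  proof -
    have "escape y z = (\<Sum>t\<in>N z - {y}. P z t * w t)"
      unfolding escape_eq[OF that] by (intro sum.cong) (auto simp: w_def)
    also have "\<dots> = (\<Sum>t\<in>N z. P z t * w t)"
      using that by (intro sum.mono_neutral_left) (auto simp: finite_N w_def)
    finally show ?thesis .
  qed
  have sub: "w z \<le> (\<Sum>t\<in>N z. P z t * w t)" if "z \<in> V" for z
    unfolding eq[OF that, symmetric] using escape_nonneg[OF that, of y] by (auto simp: w_def)
  \<comment> \<open>Optional stopping at the first visit to \<open>x\<close> or at time n: a path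
    that has visited \<open>x\<close> contributes at most \<open>w x\<close>, and the others, of
    probability \<open>avoid x n z\<close>, contribute at most 1 each.\<close>
  have le: "w z \<le> w x + avoid x n z" if "z \<in> V" for z n
    using that
  proof (induction n arbitrary: z)
    case 0
    then show ?case using w[of z] w[of x] x by simp
  next
    case (Suc n)
    have "(\<Sum>t\<in>N z. P z t * w t)
      \<le> (\<Sum>t\<in>N z. P z t * w x + (if t = x then 0 else P z t * avoid x n t))"
    proof (rule sum_mono)
      fix t
      assume t: "t \<in> N z"
      have "P z t * w t \<le> P z t * (w x + avoid x n t)"
        using Suc.prems t N_in_V[OF Suc.prems] by (intro mult_left_mono Suc.IH nonneg_N) auto
      then show "P z t * w t \<le> P z t * w x + (if t = x then 0 else P z t * avoid x n t)"
        by (auto simp: algebra_simps)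
    qed
    also have "\<dots> = w x + (\<Sum>t\<in>N z. if t = x then 0 else P z t * avoid x n t)"
      using sum_N[OF Suc.prems] by (simp add: sum.distrib flip: sum_distrib_right)
    also have "(\<Sum>t\<in>N z. if t = x then 0 else P z t * avoid x n t) = avoid x (Suc n) z"
      unfolding avoid.simps using Suc.prems
      by (intro sum.mono_neutral_cong_right) (auto simp: finite_N)
    finally show ?case using sub[OF Suc.prems] by linarith
  qed
  have max: "w z \<le> w x" if z: "(x, z) \<in> edges\<^sup>*" for z
  proof -
    have zV: "z \<in> V" using edges_rtrancl_in_V x z by blast
    have "(\<lambda>n. w x + avoid x n z) \<longlonglongrightarrow> w x + escape x z"
      by (intro tendsto_add tendsto_const avoid_tendsto zV)
    then show ?thesis
      using LIMSEQ_le_const[of _ "w x + escape x z" "w z"] le[OF zV] escape_eq_0_reachable[OF x z]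
      by auto
  qed
  \<comment> \<open>At a vertex where the maximum \<open>w x\<close> is attained, subharmonicity
    makes the average of the nonnegative numbers \<open>w x - w s\<close> vanish, so each successor
    attains it too.\<close>
  have const: "w z = w x" if "(x, z) \<in> edges\<^sup>*" for z
    using that
  proof induction
    case (step z t)
    have zV: "z \<in> V" and t: "t \<in> N z" "0 < P z t" using step by (auto simp: edges_def)
    have nn: "0 \<le> P z s * (w x - w s)" if "s \<in> N z" for s
    proof (cases "0 < P z s")
      case True
      then have "(x, s) \<in> edges\<^sup>*"
        using step.hyps(1) that zV by (auto simp: edges_def intro: rtrancl_into_rtrancl)
      then show ?thesis using max True by simp
    next
      case False
      then show ?thesis using nonneg_N[OF zV that] by simp
    qed
    have "(\<Sum>s\<in>N z. P z s * (w x - w s)) = w x - (\<Sum>s\<in>N z. P z s * w s)"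
      using sum_N[OF zV] by (simp add: right_diff_distrib sum_subtractf flip: sum_distrib_right)
    then have "(\<Sum>s\<in>N z. P z s * (w x - w s)) = 0"
      using sub[OF zV] step.IH sum_nonneg[of "N z" "\<lambda>s. P z s * (w x - w s)"] nn by force
    then have "P z t * (w x - w t) = 0"
      by (rule sum_nonneg_0[OF finite_N[OF zV], rotated]) (use nn t in auto)
    then show ?case using t by simp
  qed simp
  have "w x = 0" using const[OF xy] by (simp add: w_def)
  have "P y t * w t = 0" if t: "t \<in> N y" for t
  proof (cases "0 < P y t")
    case True
    then have "(x, t) \<in> edges\<^sup>*" using xy t y by (auto simp: edges_def intro: rtrancl_into_rtrancl)
    then show ?thesis using const \<open>w x = 0\<close> by simp
  next
    case False
    then show ?thesis using nonneg_N[OF y t] by simp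
  qed
  then show ?thesis unfolding eq[OF y] by (intro sum.neutral) auto
qed

text \<open>In the next lemma \<open>e m y\<close> is the probability that the chain started at \<open>y\<close> leaves \<open>K m\<close>
  before it visits \<open>a\<close>, time \<open>0\<close> included.\<close>

lemma exit_probability_tendsto_escape:
  assumes a: "a \<in> C" and C: "C \<subseteq> V"
    and closed: "\<And>y z. y \<in> C \<Longrightarrow> (y, z) \<in> edges \<Longrightarrow> z \<in> C"
    and reach: "\<And>y. y \<in> C \<Longrightarrow> (y, a) \<in> edges\<^sup>*"
    and K: "\<And>m. finite (K m)" "\<And>y. y \<in> C \<Longrightarrow> \<forall>\<^sub>F m in sequentially. y \<in> K m"
    and e_bounds: "\<And>m y. 0 \<le> e m y" "\<And>m y. e m y \<le> 1"
    and e_a: "\<And>m. e m a = 0"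
    and e_out: "\<And>m y. y \<in> C \<Longrightarrow> y \<notin> K m \<Longrightarrow> y \<noteq> a \<Longrightarrow> e m y = 1"
    and e_harm: "\<And>m y. y \<in> C \<Longrightarrow> y \<in> K m \<Longrightarrow> y \<noteq> a \<Longrightarrow> e m y = (\<Sum>z\<in>N y. P y z * e m z)"
  shows "(\<lambda>m. \<Sum>z\<in>N a. P a z * e m z) \<longlonglongrightarrow> escape a a"
proof -
  have aV: "a \<in> V" using a C by blast
  have drop_a: "(\<Sum>z\<in>N y. P y z * e m z) = (\<Sum>z\<in>N y - {a}. P y z * e m z)" if "y \<in> V" for y m
    using that e_a by (intro sum.mono_neutral_right) (auto simp: finite_N)
  \<comment> \<open>Neighbors outside \<open>C\<close> carry real probability 0. This makes the
    values of \<open>e m\<close> off \<open>C\<close>, about which only the bounds are assumed,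
    harmless.\<close>
  have pos_C: "P y z = 0 \<or> z \<in> C" if "y \<in> C" "z \<in> N y" for y z
  proof -
    have "0 \<le> P y z" using that C nonneg_N by blast
    then show ?thesis using closed[of y z] that C by (force simp: edges_def)
  qed
  \<comment> \<open>Within n steps the chain reaches only finitely many vertices, and those in
    \<open>C\<close> lie in \<open>K m\<close> for large m. Leaving \<open>K m\<close> before
    visiting \<open>a\<close> then takes more than n steps and entails avoiding \<open>a\<close>
    during them.\<close>
  have upper: "\<forall>\<^sub>F m in sequentially. e m y \<le> avoid a n y" if "y \<in> C" for n y
    using that
  proof (induction n arbitrary: y)
    case 0
    then show ?case using e_bounds by simp
  next
    case (Suc n)
    then have yV: "y \<in> V" using C by blast
    show ?case
    proof (cases "y = a")
      case True
      then show ?thesis using e_a avoid_nonneg[OF aV, of a "Suc n"] by (simp del: avoid.simps)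
    next
      case False
      have "\<forall>\<^sub>F m in sequentially. \<forall>z\<in>N y. z \<in> C \<longrightarrow> e m z \<le> avoid a n z"
        using finite_N[OF yV] Suc.IH by (intro eventually_ball_finite) auto
      then show ?thesis
        using K(2)[OF Suc.prems]
      proof eventually_elim
        case (elim m)
        have "e m y = (\<Sum>z\<in>N y - {a}. P y z * e m z)"
          using e_harm[OF Suc.prems _ False] elim drop_a[OF yV] by simp
        also have "\<dots> \<le> (\<Sum>z\<in>N y - {a}. P y z * avoid a n z)"
        proof (rule sum_mono)
          fix z
          assume z: "z \<in> N y - {a}"
          then show "P y z * e m z \<le> P y z * avoid a n z"
            using pos_C[OF Suc.prems, of z] elim nonneg_N[OF yV, of z]
            by (auto intro: mult_left_mono)
        qed
        finally show ?case by simp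
      qed
    qed
  qed
  \<comment> \<open>The chain cannot stay forever in the finite set
    \<open>K m \<inter> C - {a}\<close>, as \<open>a\<close> is reachable from it. Analytically this
    is the maximum principle for the difference of the two harmonic functions, set to 0 at
    \<open>a\<close> because \<open>escape a a\<close> may be positive.\<close>
  have lower: "escape a y \<le> e m y" if y: "y \<in> C" "y \<noteq> a" for y m
  proof (cases "y \<in> K m")
    case False
    then show ?thesis using e_out[OF y(1) False y(2)] escape_le_1 C y by auto
  next
    case True
    define u where "u z = (if z = a then 0 else escape a z - e m z)" for z
    define D where "D = K m \<inter> C - {a}"
    have D: "z \<in> V" "z \<in> C" "z \<in> K m" "z \<noteq> a" if "z \<in> D" for z using that C by (auto simp: D_def)
    have "u y \<le> 0"
    proof (rule discrete_maximum_principle[of D N P u])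
      show "finite D" using K by (simp add: D_def)
      show "y \<in> D" using True y by (simp add: D_def)
      show "finite (N z)" if "z \<in> D" for z using D[OF that] finite_N by blast
      show "0 \<le> P z t" if "z \<in> D" "t \<in> N z" for z t
        using D[OF that(1)] that nonneg_N by blast
      show "0 \<le> (\<Sum>t\<in>N z. P z t * (u t - u z))" if "z \<in> D" for z
      proof -
        note z = D[OF that]
        have "(\<Sum>t\<in>N z. P z t * u t) = (\<Sum>t\<in>N z - {a}. P z t * u t)"
          using z by (intro sum.mono_neutral_right) (auto simp: finite_N u_def)
        also have "\<dots> = (\<Sum>t\<in>N z - {a}. P z t * escape a t) - (\<Sum>t\<in>N z - {a}. P z t * e m t)"
          unfolding sum_subtractf[symmetric]
          by (intro sum.cong) (auto simp: u_def algebra_simps)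
        also have "\<dots> = u z"
          using escape_eq[OF z(1), of a] e_harm[OF z(2-4)] drop_a[OF z(1)] z(4)
          by (simp add: u_def)
        finally show ?thesis
          using sum_N[OF z(1)] by (simp add: right_diff_distrib sum_subtractf flip: sum_distrib_right)
      qed
      show "u t \<le> 0" if z: "z \<in> D" "t \<in> N z" "0 < P z t" "t \<notin> D" for z t
      proof (cases "t = a")
        case False
        have "t \<in> C" using pos_C[of z t] z D by auto
        then show ?thesis
          using False z(4) e_out[of t m] escape_le_1[of t a] C by (auto simp: u_def D_def)
      qed (simp add: u_def)
      show "\<exists>t. t \<notin> D \<and> (z, t) \<in> {(y, z). z \<in> N y \<and> 0 < P y z}\<^sup>*" if "z \<in> D" for z
      proof (intro exI conjI)
        show "a \<notin> D" by (simp add: D_def)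
        have "edges\<^sup>* \<subseteq> {(y, z). z \<in> N y \<and> 0 < P y z}\<^sup>*"
          by (rule rtrancl_mono) (auto simp: edges_def)
        then show "(z, a) \<in> {(y, z). z \<in> N y \<and> 0 < P y z}\<^sup>*"
          using reach D[OF that] by blast
      qed
    qed
    then show ?thesis using y by (simp add: u_def)
  qed
  have low: "escape a a \<le> (\<Sum>z\<in>N a. P a z * e m z)" for m
    unfolding escape_eq[OF aV, of a] drop_a[OF aV]
  proof (rule sum_mono)
    fix z
    assume z: "z \<in> N a - {a}"
    then show "P a z * escape a z \<le> P a z * e m z"
      using pos_C[OF a, of z] lower[of z m] nonneg_N[OF aV, of z]
      by (auto intro: mult_left_mono)
  qed
  have up: "\<forall>\<^sub>F m in sequentially. (\<Sum>z\<in>N a. P a z * e m z) \<le> avoid a (Suc n) a" for n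
  proof -
    have "\<forall>\<^sub>F m in sequentially. \<forall>z\<in>N a. z \<in> C \<longrightarrow> e m z \<le> avoid a n z"
      using finite_N[OF aV] upper by (intro eventually_ball_finite) auto
    then show ?thesis
    proof eventually_elim
      case (elim m)
      have "(\<Sum>z\<in>N a - {a}. P a z * e m z) \<le> (\<Sum>z\<in>N a - {a}. P a z * avoid a n z)"
      proof (rule sum_mono)
        fix z
        assume z: "z \<in> N a - {a}"
        then show "P a z * e m z \<le> P a z * avoid a n z"
          using pos_C[OF a, of z] elim nonneg_N[OF aV, of z]
          by (auto intro: mult_left_mono)
      qed
      then show ?case using drop_a[OF aV] by simp
    qed
  qed
  show ?thesis
  proof (rule order_tendstoI)
    fix r
    assume "r < escape a a"
    then show "\<forall>\<^sub>F m in sequentially. r < (\<Sum>z\<in>N a. P a z * e m z)"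
      using low by (auto intro: always_eventually less_le_trans)
  next
    fix r
    assume "escape a a < r"
    then have "\<forall>\<^sub>F n in sequentially. avoid a (Suc n) a < r"
      using order_tendstoD(2)[OF LIMSEQ_Suc[OF avoid_tendsto[OF aV]]] by blast
    then obtain n where n: "avoid a (Suc n) a < r"
      by (meson eventually_happens trivial_limit_sequentially)
    show "\<forall>\<^sub>F m in sequentially. (\<Sum>z\<in>N a. P a z * e m z) < r"
      using up[of n] by eventually_elim (use n in linarith)
  qed
qed

end

section \<open>From the transition matrix to infinitely many visits of the chain\<close>

context markov_kernel
begin

context
  fixes M :: "'w measure" and X :: "nat \<Rightarrow> 'w \<Rightarrow> 'v" and x :: 'v
  assumes chain: "markov_chain V P x M X"
begin

interpretation prob_space M
  using chain by (simp add: markov_chain_def)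

lemma chain_measurable [measurable]: "X n \<in> measurable M (count_space V)"
  using chain by (simp add: markov_chain_def)

lemma chain_in_V: "\<omega> \<in> space M \<Longrightarrow> X n \<omega> \<in> V"
  using measurable_space[OF chain_measurable] by simp

lemma chain_eq_event: "{\<omega> \<in> space M. X n \<omega> = z} \<in> events"
proof (cases "z \<in> V")
  case True
  then show ?thesis by measurable
next
  case False
  then have "{\<omega> \<in> space M. X n \<omega> = z} = {}" using chain_in_V by auto
  then show ?thesis by simp
qed

lemma path_event: "{\<omega> \<in> space M. (\<forall>i\<le>m. X i \<omega> = s i) \<and> (\<forall>k. m < k \<and> k \<le> m + n \<longrightarrow> X k \<omega> \<noteq> a)} \<in> events"
proof -
  have "{\<omega> \<in> space M. (\<forall>i\<le>m. X i \<omega> = s i) \<and> (\<forall>k. m < k \<and> k \<le> m + n \<longrightarrow> X k \<omega> \<noteq> a)} =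
    {\<omega> \<in> space M. (\<forall>i\<in>{..m}. X i \<omega> = s i) \<and> (\<forall>k\<in>{m<..m+n}. \<not> X k \<omega> = a)}"
    by auto
  also have "\<dots> \<in> events"
    using chain_eq_event
    by (intro sets.sets_Collect_conj sets.sets_Collect_finite_All sets.sets_Collect_neg) auto
  finally show ?thesis .
qed

text \<open>This is the Markov property at time m for an event of the next n steps. It follows from
  the one-step property by prolonging the prescribed path with its next vertex, which is why the
  induction generalises over \<open>m\<close> and \<open>s\<close>.\<close>

lemma prob_path_avoid:
  assumes s: "\<And>i. s i \<in> V"
  shows "prob {\<omega> \<in> space M. (\<forall>i\<le>m. X i \<omega> = s i) \<and> (\<forall>k. m < k \<and> k \<le> m + n \<longrightarrow> X k \<omega> \<noteq> a)} =
    prob {\<omega> \<in> space M. \<forall>i\<le>m. X i \<omega> = s i} * avoid a n (s m)"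
  using s
proof (induction n arbitrary: m s)
  case 0
  have "{\<omega> \<in> space M. (\<forall>i\<le>m. X i \<omega> = s i) \<and> (\<forall>k. m < k \<and> k \<le> m + 0 \<longrightarrow> X k \<omega> \<noteq> a)}
    = {\<omega> \<in> space M. \<forall>i\<le>m. X i \<omega> = s i}" by auto
  then show ?case by (simp del: not_less)
next
  case (Suc n)
  define s' where "s' z = s(Suc m := z)" for z
  have s': "s' z i \<in> V" if "z \<in> V" for z i using Suc.prems that by (simp add: s'_def)
  define E where "E = {\<omega> \<in> space M. \<forall>i\<le>m. X i \<omega> = s i}"
  define A where "A = {\<omega> \<in> space M. (\<forall>i\<le>m. X i \<omega> = s i) \<and>
    (\<forall>k. m < k \<and> k \<le> m + Suc n \<longrightarrow> X k \<omega> \<noteq> a)}"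
  define B where "B z = {\<omega> \<in> space M. (\<forall>i\<le>Suc m. X i \<omega> = s' z i) \<and>
    (\<forall>k. Suc m < k \<and> k \<le> Suc m + n \<longrightarrow> X k \<omega> \<noteq> a)}" for z
  have E': "{\<omega> \<in> space M. \<forall>i\<le>Suc m. X i \<omega> = s' z i} = {\<omega> \<in> E. X (Suc m) \<omega> = z}" for z
    by (auto simp: E_def s'_def le_Suc_eq)
  have step: "prob {\<omega> \<in> E. X (Suc m) \<omega> = z} = prob E * P (s m) z" if "z \<in> V" for z
  proof -
    have "prob {\<omega> \<in> space M. \<forall>i\<le>Suc m. X i \<omega> = s' z i} =
      prob {\<omega> \<in> space M. \<forall>i\<le>m. X i \<omega> = s' z i} * P (s' z m) (s' z (Suc m))"
      using chain s'[OF that] by (simp add: markov_chain_def)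
    moreover have "{\<omega> \<in> space M. \<forall>i\<le>m. X i \<omega> = s' z i} = E"
      by (auto simp: E_def s'_def)
    ultimately show ?thesis unfolding E' by (simp add: s'_def)
  qed
  have sm: "s m \<in> V" by (rule Suc.prems)
  have E_event: "E \<in> events"
    using path_event[of m s 0] by (simp add: E_def del: not_less cong: conj_cong)
  \<comment> \<open>A chain is specified by probabilities of single paths only. That the next vertex
    lies almost surely in the finite set \<open>N (s m)\<close> follows by discarding the countably
    many other vertices, each of probability 0.\<close>
  have "AE \<omega> in M. \<forall>z\<in>V - N (s m). \<not> (\<omega> \<in> E \<and> X (Suc m) \<omega> = z)"
  proof (subst AE_ball_countable)
    show "countable (V - N (s m))" using countable_V by simp
    show "\<forall>z\<in>V - N (s m). AE \<omega> in M. \<not> (\<omega> \<in> E \<and> X (Suc m) \<omega> = z)"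
    proof
      fix z
      assume z: "z \<in> V - N (s m)"
      have "E \<inter> {\<omega> \<in> space M. X (Suc m) \<omega> = z} \<in> events"
        using E_event chain_eq_event by blast
      moreover have "E \<inter> {\<omega> \<in> space M. X (Suc m) \<omega> = z} = {\<omega> \<in> E. X (Suc m) \<omega> = z}"
        by (auto simp: E_def)
      moreover have "prob {\<omega> \<in> E. X (Suc m) \<omega> = z} = 0"
        using step[of z] z outside_N[OF sm] by simp
      ultimately show "AE \<omega> in M. \<not> (\<omega> \<in> E \<and> X (Suc m) \<omega> = z)"
        using prob_eq_0[of "{\<omega> \<in> E. X (Suc m) \<omega> = z}"] by simp
    qed
  qed
  then have ae: "AE \<omega> in M. \<omega> \<in> E \<longrightarrow> X (Suc m) \<omega> \<in> N (s m)"
    using AE_space by eventually_elim (use chain_in_V in blast)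
  have B_event: "B z \<in> events" for z unfolding B_def by (rule path_event)
  have A_event: "A \<in> events" unfolding A_def by (rule path_event)
  have A_iff: "\<omega> \<in> A \<longleftrightarrow> X (Suc m) \<omega> \<noteq> a \<and> \<omega> \<in> B (X (Suc m) \<omega>)" for \<omega>
  proof -
    have "(\<forall>k. m < k \<and> k \<le> m + Suc n \<longrightarrow> X k \<omega> \<noteq> a) \<longleftrightarrow>
      X (Suc m) \<omega> \<noteq> a \<and> (\<forall>k. Suc m < k \<and> k \<le> Suc m + n \<longrightarrow> X k \<omega> \<noteq> a)"
      by (metis Suc_leI Suc_lessD add_Suc add_Suc_right le_add1 lessI nat_less_le)
    then show ?thesis by (auto simp: A_def B_def s'_def le_Suc_eq)
  qed
  have B_X: "\<omega> \<in> B z \<Longrightarrow> X (Suc m) \<omega> = z" for \<omega> z by (auto simp: B_def s'_def)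
  have "prob A = prob (\<Union>z\<in>N (s m) - {a}. B z)"
  proof (rule measure_eq_AE)
    show "AE \<omega> in M. \<omega> \<in> A \<longleftrightarrow> \<omega> \<in> (\<Union>z\<in>N (s m) - {a}. B z)"
      using ae
    proof eventually_elim
      case (elim \<omega>)
      have "\<omega> \<in> A \<Longrightarrow> \<omega> \<in> E" by (auto simp: A_def E_def)
      then show ?case using elim A_iff B_X by blast
    qed
    show "(\<Union>z\<in>N (s m) - {a}. B z) \<in> events"
      using B_event finite_N[OF sm] by (intro sets.finite_UN) auto
  qed (rule A_event)
  also have "\<dots> = (\<Sum>z\<in>N (s m) - {a}. prob (B z))"
  proof (rule finite_measure_finite_Union)
    show "disjoint_family_on B (N (s m) - {a})"
      unfolding disjoint_family_on_def using B_X by blast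
  qed (use B_event finite_N[OF sm] in auto)
  also have "\<dots> = (\<Sum>z\<in>N (s m) - {a}. prob E * (P (s m) z * avoid a n z))"
  proof (rule sum.cong)
    fix z
    assume "z \<in> N (s m) - {a}"
    then have z: "z \<in> V" using N_in_V[OF sm] by blast
    show "prob (B z) = prob E * (P (s m) z * avoid a n z)"
      unfolding B_def Suc.IH[of "s' z" "Suc m", OF s'[OF z]] E' step[OF z]
      by (simp add: s'_def)
  qed simp
  finally show ?case
    unfolding A_def E_def by (simp only: avoid.simps sum_distrib_left)
qed

text \<open>Continuity of the measure from above passes from avoiding \<open>a\<close> during n
  steps to avoiding it forever.\<close>

lemma prob_path_escape:
  assumes s: "\<And>i. s i \<in> V"
  shows "prob {\<omega> \<in> space M. (\<forall>i\<le>m. X i \<omega> = s i) \<and> (\<forall>k>m. X k \<omega> \<noteq> a)} =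
      prob {\<omega> \<in> space M. \<forall>i\<le>m. X i \<omega> = s i} * escape a (s m)" (is ?prob)
    and "{\<omega> \<in> space M. (\<forall>i\<le>m. X i \<omega> = s i) \<and> (\<forall>k>m. X k \<omega> \<noteq> a)} \<in> events" (is ?event)
proof -
  define A where "A n = {\<omega> \<in> space M. (\<forall>i\<le>m. X i \<omega> = s i) \<and>
    (\<forall>k. m < k \<and> k \<le> m + n \<longrightarrow> X k \<omega> \<noteq> a)}" for n
  have eq: "{\<omega> \<in> space M. (\<forall>i\<le>m. X i \<omega> = s i) \<and> (\<forall>k>m. X k \<omega> \<noteq> a)} = (\<Inter>n. A n)"
  proof (intro equalityI subsetI INT_I)
    fix \<omega>
    assume "\<omega> \<in> (\<Inter>n. A n)"
    then have *: "\<omega> \<in> A n" for n by blast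
    have "X k \<omega> \<noteq> a" if "m < k" for k using *[of "k - m"] that by (auto simp: A_def)
    then show "\<omega> \<in> {\<omega> \<in> space M. (\<forall>i\<le>m. X i \<omega> = s i) \<and> (\<forall>k>m. X k \<omega> \<noteq> a)}"
      using *[of 0] by (auto simp: A_def)
  qed (auto simp: A_def)
  have A: "A n \<in> events" for n unfolding A_def by (rule path_event)
  then show ?event unfolding eq by blast
  have "(\<lambda>n. prob (A n)) \<longlonglongrightarrow> prob (\<Inter>n. A n)"
    using A by (intro finite_Lim_measure_decseq) (auto simp: A_def decseq_def)
  moreover have "(\<lambda>n. prob (A n)) \<longlonglongrightarrow>
      prob {\<omega> \<in> space M. \<forall>i\<le>m. X i \<omega> = s i} * escape a (s m)"
    unfolding A_def prob_path_avoid[of s, OF s]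
    by (intro tendsto_mult tendsto_const avoid_tendsto s)
  ultimately show ?prob unfolding eq by (rule LIMSEQ_unique)
qed

lemma infinite_visits_event: "{\<omega> \<in> space M. infinite {n. X n \<omega> = a}} \<in> events"
proof -
  have "{\<omega> \<in> space M. infinite {n. X n \<omega> = a}} = {\<omega> \<in> space M. \<forall>m. \<exists>n. m < n \<and> X n \<omega> = a}"
    by (simp add: infinite_nat_iff_unbounded)
  also have "\<dots> \<in> events"
    using chain_eq_event
    by (intro sets.sets_Collect_countable_All sets.sets_Collect_countable_Ex sets.sets_Collect_conj) auto
  finally show ?thesis .
qed

lemma AE_initial: "AE \<omega> in M. X 0 \<omega> = x"
proof -
  have "AE \<omega> in M. \<omega> \<in> {\<omega> \<in> space M. X 0 \<omega> = x}"
    using chain prob_eq_1[OF chain_eq_event[of 0 x]] unfolding markov_chain_def by blast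
  then show ?thesis by eventually_elim simp
qed

lemma AE_infinite_visits:
  assumes x: "x \<in> V" and 0: "escape x x = 0"
  shows "AE \<omega> in M. infinite {n. X n \<omega> = x}"
proof -
  \<comment> \<open>The default value \<open>x\<close> stands at index \<open>length l\<close>, so
    \<open>L l\<close> is the event that the chain runs through \<open>l\<close>, is then at
    \<open>x\<close>, and never again. Such histories of the last visit are countable in
    number.\<close>
  define s where "s l i = (if i < length l then l ! i else x)" for l i
  define L where "L l = {\<omega> \<in> space M. (\<forall>i\<le>length l. X i \<omega> = s l i) \<and> (\<forall>k>length l. X k \<omega> \<noteq> x)}" for l
  have "AE \<omega> in M. \<forall>l\<in>lists V. \<omega> \<notin> L l"
  proof (subst AE_ball_countable)
    show "countable (lists V)" using countable_V by (rule countable_lists)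
    show "\<forall>l\<in>lists V. AE \<omega> in M. \<omega> \<notin> L l"
    proof
      fix l
      assume l: "l \<in> lists V"
      then have s: "s l i \<in> V" for i using x by (auto simp: s_def in_listsD)
      have "s l (length l) = x" by (simp add: s_def)
      then have "prob (L l) = 0" "L l \<in> events"
        using prob_path_escape[of "s l" "length l" x, OF s] 0 unfolding L_def by auto
      then show "AE \<omega> in M. \<omega> \<notin> L l" using prob_eq_0 by blast
    qed
  qed
  then show ?thesis
    using AE_initial AE_space
  proof eventually_elim
    case (elim \<omega>)
    show ?case
    proof
      assume fin: "finite {n. X n \<omega> = x}"
      define m where "m = Max {n. X n \<omega> = x}"
      have ne: "{n. X n \<omega> = x} \<noteq> {}" using elim by blast
      have m: "X m \<omega> = x" using Max_in[OF fin ne] by (simp add: m_def)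
      have after: "X k \<omega> \<noteq> x" if "m < k" for k
        using Max_ge[OF fin, of k] that by (auto simp: m_def)
      define l where "l = map (\<lambda>i. X i \<omega>) [0..<m]"
      have "l \<in> lists V" using chain_in_V elim by (auto simp: l_def)
      moreover have "\<omega> \<in> L l" using m after elim by (auto simp: L_def l_def s_def)
      ultimately show False using elim by blast
    qed
  qed
qed

lemma prob_infinite_visits_less_1:
  assumes x: "x \<in> V" and pos: "0 < escape x x"
  shows "prob {\<omega> \<in> space M. infinite {n. X n \<omega> = x}} < 1"
proof -
  define A where "A = {\<omega> \<in> space M. (\<forall>i\<le>0. X i \<omega> = x) \<and> (\<forall>k>0. X k \<omega> \<noteq> x)}"
  have "prob A = escape x x" "A \<in> events"
    using prob_path_escape[of "\<lambda>_. x" 0 x] x chain by (auto simp: A_def markov_chain_def)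
  moreover have "{\<omega> \<in> space M. infinite {n. X n \<omega> = x}} \<inter> A = {}"
  proof -
    have "finite {n. X n \<omega> = x}" if "\<omega> \<in> A" for \<omega>
    proof (rule finite_subset)
      show "{n. X n \<omega> = x} \<subseteq> {0}" using that by (auto simp: A_def)
    qed simp
    then show ?thesis by auto
  qed
  ultimately show ?thesis
    using finite_measure_Union[OF infinite_visits_event[of x], of A] pos
      prob_le_1[of "{\<omega> \<in> space M. infinite {n. X n \<omega> = x}} \<union> A"]
    by linarith
qed

end

text \<open>Recurrence speaks of all realizations, so deducing \<open>escape x x = 0\<close> from it
  requires one to exist; \<open>markov_chain_exists\<close> supplies it. Apart from the one-point
  graph, sample spaces disappear from the argument here.\<close>

lemma recurrent_vertex_iff:
  assumes x: "x \<in> V"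
  shows "recurrent_vertex V P x \<longleftrightarrow> escape x x = 0"
proof
  assume 0: "escape x x = 0"
  show "recurrent_vertex V P x"
    unfolding recurrent_vertex_def
  proof (intro allI impI)
    fix M :: "(nat \<Rightarrow> 'v) measure" and X
    assume chain: "markov_chain V P x M X"
    have "prob_space M" using chain unfolding markov_chain_def by blast
    then interpret prob_space M .
    have "AE \<omega> in M. \<omega> \<in> {\<omega> \<in> space M. infinite {n. X n \<omega> = x}}"
      using AE_infinite_visits[OF chain x 0] AE_space by eventually_elim simp
    then show "prob {\<omega> \<in> space M. infinite {n. X n \<omega> = x}} = 1"
      using prob_eq_1[OF infinite_visits_event[OF chain]] by blast
  qed
next
  assume rec: "recurrent_vertex V P x"
  have "(P y has_sum 1) V" if y: "y \<in> V" for y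
  proof -
    have "(P y has_sum 1) (N y)" using has_sum_finite[OF finite_N[OF y], of "P y"] sum_N[OF y] by simp
    then show ?thesis
      using has_sum_cong_neutral[of V "N y" "P y" "P y"] N_subset[OF y] outside_N[OF y] by auto
  qed
  then obtain M :: "(nat \<Rightarrow> 'v) measure" and X where chain: "markov_chain V P x M X"
    using markov_chain_exists[OF countable_V x] nonneg by blast
  show "escape x x = 0"
    using prob_infinite_visits_less_1[OF chain x] rec chain escape_nonneg[OF x, of x]
    by (force simp: recurrent_vertex_def)
qed

end

subsection \<open>Weighted networks\<close>

text \<open>Uniqueness forces existence for a square linear system, shown here by eliminating one
  vertex at a time. Uniqueness is required on every subset of \<open>D\<close> so that it survives
  in the induction.\<close>

lemma dirichlet_problem_solvable:
  fixes T :: "('v \<Rightarrow> 'k::field) \<Rightarrow> 'v \<Rightarrow> 'k"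
  assumes D: "finite D"
    and linear: "\<And>u w c x. T (\<lambda>z. u z + c * w z) x = T u x + c * T w x"
    and unique: "\<And>A u. A \<subseteq> D \<Longrightarrow> (\<And>x. x \<notin> A \<Longrightarrow> u x = 0) \<Longrightarrow> (\<And>x. x \<in> A \<Longrightarrow> T u x = 0) \<Longrightarrow>
      u = (\<lambda>_. 0)"
  shows "\<exists>v. (\<forall>x. x \<notin> D \<longrightarrow> v x = f x) \<and> (\<forall>x\<in>D. T v x = 0)"
  using D unique
proof (induction D arbitrary: f)
  case empty
  then show ?case by auto
next
  case (insert s D)
  have IH: "\<exists>v. (\<forall>x. x \<notin> D \<longrightarrow> v x = f x) \<and> (\<forall>x\<in>D. T v x = 0)" for f
  proof (rule insert.IH)
    show "u = (\<lambda>_. 0)"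
      if "A \<subseteq> D" "\<And>x. x \<notin> A \<Longrightarrow> u x = 0" "\<And>x. x \<in> A \<Longrightarrow> T u x = 0" for A u
      using insert.prems[of A u] that by blast
  qed
  obtain u where u: "\<And>x. x \<notin> D \<Longrightarrow> u x = f x" "\<And>x. x \<in> D \<Longrightarrow> T u x = 0"
    using IH[of f] by blast
  obtain g where g: "\<And>x. x \<notin> D \<Longrightarrow> g x = (if x = s then 1 else 0)" "\<And>x. x \<in> D \<Longrightarrow> T g x = 0"
    using IH[of "\<lambda>x. if x = s then 1 else 0"] by blast
  have "g s = 1" using g insert.hyps by simp
  have "T g s \<noteq> 0"
  proof
    assume "T g s = 0"
    then have "g = (\<lambda>_. 0)" using g by (intro insert.prems[of "insert s D"]) auto
    with \<open>g s = 1\<close> show False by simp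
  qed
  \<comment> \<open>The solution \<open>g\<close> with unit value at \<open>s\<close> corrects
    \<open>u\<close> so that the equation also holds at \<open>s\<close>; the divisor is nonzero by
    uniqueness on \<open>insert s D\<close>.\<close>
  define v where "v x = u x + (- (T u s / T g s)) * g x" for x
  have "T v x = T u x + (- (T u s / T g s)) * T g x" for x
    unfolding v_def by (rule linear)
  then have "T v x = 0" if "x \<in> insert s D" for x
    using that u g \<open>T g s \<noteq> 0\<close> by auto
  moreover have "v x = f x" if "x \<notin> insert s D" for x
    using that u g by (simp add: v_def)
  ultimately show ?case by blast
qed

section \<open>Comparison of magnitudes up to rational factors\<close>

definition dominated :: "'k::linordered_field \<Rightarrow> 'k \<Rightarrow> bool" where
  "dominated k l \<longleftrightarrow> (\<exists>c::rat. 0 < c \<and> k < of_rat c * l)"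

lemma dominated_trans:
  assumes "dominated k l" "dominated l m" 
  shows "dominated k m"
proof -
  obtain c d where c: "0 < c" "k < of_rat c * l" and d: "0 < d" "l < of_rat d * m"
    using assms by (auto simp: dominated_def)
  have "of_rat c * l < of_rat c * (of_rat d * m)" using c d by simp
  then have "k < of_rat (c * d) * m" using c(2) by (simp add: of_rat_mult mult.assoc)
  then show ?thesis unfolding dominated_def using c d by (intro exI[of _ "c * d"]) simp
qed

lemma dominated_le:
  assumes "0 < l" "k \<le> l"
  shows "dominated k l"
  unfolding dominated_def
proof (intro exI conjI)
  show "k < of_rat 2 * l" using assms by simp
qed simp

text \<open>The two rational bounds are separated because along an edge of the real chain only one
  is available: the degree of the start is dominated by that of the end.\<close>

lemma comparable_iff: "comparable k l \<longleftrightarrow> 0 < k \<and> 0 < l \<and> dominated k l \<and> dominated l k"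
proof -
  have "(\<exists>c::rat. 0 < c \<and> of_rat c < k / l) \<longleftrightarrow> dominated l k" if "0 < k" "0 < l"
  proof
    assume "\<exists>c::rat. 0 < c \<and> of_rat c < k / l"
    then obtain c :: rat where c: "0 < c" "of_rat c < k / l" by blast
    then have "l < of_rat (1 / c) * k" using that by (simp add: of_rat_divide field_simps)
    then show "dominated l k" unfolding dominated_def using c by (intro exI[of _ "1 / c"]) simp
  next
    assume "dominated l k"
    then obtain c :: rat where c: "0 < c" "l < of_rat c * k" by (auto simp: dominated_def)
    then have "of_rat (1 / c) < k / l" using that by (simp add: of_rat_divide field_simps)
    then show "\<exists>c::rat. 0 < c \<and> of_rat c < k / l" using c by (intro exI[of _ "1 / c"]) simp
  qed
  moreover have "(\<exists>c::rat. 0 < c \<and> k / l < of_rat c) \<longleftrightarrow> dominated k l" if "0 < l"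
    using that by (simp add: dominated_def field_simps)
  ultimately show ?thesis by (auto simp: comparable_def)
qed

lemma comparable_refl: "0 < k \<Longrightarrow> comparable k k"
  by (simp add: comparable_iff dominated_le)

lemma comparable_sym: "comparable k l \<Longrightarrow> comparable l k"
  by (simp add: comparable_iff)

lemma comparable_trans: "comparable k l \<Longrightarrow> comparable l m \<Longrightarrow> comparable k m"
  unfolding comparable_iff using dominated_trans by blast

text \<open>Paths with side conditions on their edges become reflexive transitive closures, which
  covers strong links, essentiality and connectedness at once. The conjunct \<open>x \<in> V\<close>
  is there because the closure is reflexive everywhere.\<close>

lemma path_between_iff_rtrancl:
  "(\<exists>xs. path_between V b x y xs \<and> (\<forall>i. Suc i < length xs \<longrightarrow> R (xs ! i) (xs ! Suc i))) \<longleftrightarrow>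
    x \<in> V \<and> (x, y) \<in> {(u, v). u \<in> V \<and> v \<in> V \<and> 0 < b u v \<and> R u v}\<^sup>*" (is "?path \<longleftrightarrow> ?reach")
proof
  assume ?path
  then obtain xs where path: "path_between V b x y xs" "\<forall>i. Suc i < length xs \<longrightarrow> R (xs ! i) (xs ! Suc i)"
    by blast
  then have xs: "xs \<noteq> []" "set xs \<subseteq> V" "hd xs = x" "last xs = y"
    "\<And>i. Suc i < length xs \<Longrightarrow> 0 < b (xs ! i) (xs ! Suc i) \<and> R (xs ! i) (xs ! Suc i)"
    by (auto simp: path_between_def)
  have "(xs ! 0, xs ! i) \<in> {(u, v). u \<in> V \<and> v \<in> V \<and> 0 < b u v \<and> R u v}\<^sup>*" if "i < length xs" for i
    using that
  proof (induction i)
    case (Suc i)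
    have "xs ! i \<in> V" "xs ! Suc i \<in> V" using Suc.prems xs(2) nth_mem[of i xs] nth_mem[of "Suc i" xs] by auto
    then have "(xs ! i, xs ! Suc i) \<in> {(u, v). u \<in> V \<and> v \<in> V \<and> 0 < b u v \<and> R u v}"
      using xs(5)[OF Suc.prems] by simp
    then show ?case using Suc by (meson Suc_lessD rtrancl_into_rtrancl)
  qed simp
  from this[of "length xs - 1"] show ?reach
    using xs by (auto simp: hd_conv_nth last_conv_nth)
next
  assume r: ?reach
  then have "(x, y) \<in> {(u, v). u \<in> V \<and> v \<in> V \<and> 0 < b u v \<and> R u v}\<^sup>*" by blast
  then show ?path
  proof induction
    case base
    show ?case using r by (intro exI[of _ "[x]"]) (simp add: path_between_def)
  next
    case (step u v)
    then obtain xs where xs: "path_between V b x u xs"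
      "\<forall>i. Suc i < length xs \<longrightarrow> R (xs ! i) (xs ! Suc i)" by blast
    have uv: "0 < b u v" "R u v" "v \<in> V" using step by auto
    have last: "xs ! i = u" if "Suc i = length xs" for i
    proof -
      have "length xs - 1 = i" using that by simp
      then show ?thesis using xs(1) by (auto simp: path_between_def last_conv_nth)
    qed
    have "0 < b ((xs @ [v]) ! i) ((xs @ [v]) ! Suc i) \<and> R ((xs @ [v]) ! i) ((xs @ [v]) ! Suc i)"
      if i: "Suc i < length (xs @ [v])" for i
    proof (cases "Suc i = length xs")
      case True
      then show ?thesis using last uv by (simp add: nth_append)
    next
      case False
      then show ?thesis using i xs by (simp add: nth_append path_between_def)
    qed
    then show ?case
      using xs(1) uv by (intro exI[of _ "xs @ [v]"]) (auto simp: path_between_def)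
  qed
qed

section \<open>The real chain of a network with positive degrees\<close>

locale weighted_network =
  fixes V :: "'v set" and b :: "'v \<Rightarrow> 'v \<Rightarrow> 'k::linordered_field"
  assumes countable: "countable V"
    and graph: "weighted_graph V b"
    and locally_finite: "locally_finite V b"
    and vdegree_pos: "\<And>x. x \<in> V \<Longrightarrow> 0 < vdegree V b x"
begin

abbreviation "deg \<equiv> vdegree V b"

lemma b_sym: "x \<in> V \<Longrightarrow> y \<in> V \<Longrightarrow> b x y = b y x"
  and b_nonneg: "x \<in> V \<Longrightarrow> y \<in> V \<Longrightarrow> 0 \<le> b x y"
  using graph by (auto simp: weighted_graph_def)

lemma finite_neighbors: "x \<in> V \<Longrightarrow> finite (neighbors V b x)"
  using locally_finite by (simp add: locally_finite_def)

lemma neighbors_iff: "y \<in> neighbors V b x \<longleftrightarrow> y \<in> V \<and> 0 < b x y"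
  by (simp add: neighbors_def)

lemma b_le_deg:
  assumes "x \<in> V" "y \<in> V"
  shows "b x y \<le> deg x"
proof (cases "0 < b x y")
  case True
  then show ?thesis
    unfolding vdegree_def using assms finite_neighbors
    by (intro member_le_sum) (auto simp: neighbors_iff)
next
  case False
  then show ?thesis using vdegree_pos[of x] assms by simp
qed

lemma trans_prob_bounds:
  assumes "x \<in> V" "y \<in> V"
  shows "0 \<le> trans_prob V b x y" "trans_prob V b x y \<le> 1"
  using assms b_nonneg[of x y] b_le_deg[of x y] vdegree_pos[of x] by (simp_all add: trans_prob_def)

lemma close_real_trans:
  "x \<in> V \<Longrightarrow> y \<in> V \<Longrightarrow> infinitely_close (trans_prob V b x y) (real_trans V b x y)"
  unfolding real_trans_def by (intro infinitely_close_real_part_unit trans_prob_bounds)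

lemma sum_trans_prob: "x \<in> V \<Longrightarrow> (\<Sum>y\<in>neighbors V b x. trans_prob V b x y) = 1"
  using vdegree_pos[of x] by (simp add: trans_prob_def vdegree_def flip: sum_divide_distrib)

sublocale markov_kernel V "real_trans V b" "neighbors V b"
proof
  show "countable V" by (rule countable)
  show "finite (neighbors V b x)" if "x \<in> V" for x using finite_neighbors that .
  show "neighbors V b x \<subseteq> V" for x by (auto simp: neighbors_iff)
  show "0 \<le> real_trans V b x y" if "x \<in> V" "y \<in> V" for x y
    using infinitely_close_nonneg[OF close_real_trans] trans_prob_bounds that by blast
  show "real_trans V b x y = 0" if "x \<in> V" "y \<in> V" "y \<notin> neighbors V b x" for x y
  proof -
    have "b x y = 0" using that b_nonneg[of x y] by (simp add: neighbors_iff)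
    then show ?thesis
      unfolding real_trans_def trans_prob_def by (simp add: real_part_eqI infinitely_close_0)
  qed
  \<comment> \<open>Real parts commute with finite sums, so local finiteness keeps the row sum at 1;
    infinitely many infinitesimal entries could lose mass.\<close>
  show "(\<Sum>y\<in>neighbors V b x. real_trans V b x y) = 1" if x: "x \<in> V" for x
  proof -
    have "infinitely_close (\<Sum>y\<in>neighbors V b x. trans_prob V b x y)
        (\<Sum>y\<in>neighbors V b x. real_trans V b x y)"
      using x by (intro infinitely_close_sum close_real_trans) (auto simp: neighbors_iff)
    then show ?thesis
      using real_part_eqI infinitely_close_1 unfolding sum_trans_prob[OF x] by metis
  qed
qed

text \<open>A positive real part means a positive rational lower bound for b(x,y)/b(x), while the
  upper bound holds anyway, the quotient being at most 1. Hence the steps allowed in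
  \<open>essential\<close> are exactly the steps of the real chain.\<close>

lemma edges_iff: "(x, y) \<in> edges \<longleftrightarrow> x \<in> V \<and> y \<in> V \<and> comparable (b x y) (deg x)"
proof (cases "x \<in> V \<and> y \<in> V")
  case True
  note pos = vdegree_pos[of x] and nn = b_nonneg[of x y]
  have "0 < real_trans V b x y \<longleftrightarrow> (\<exists>c::rat. 0 < c \<and> of_rat c < b x y / deg x)"
    using infinitely_close_pos_iff[OF close_real_trans[of x y]] True by (simp add: trans_prob_def)
  also have "\<dots> \<and> 0 < b x y \<longleftrightarrow> comparable (b x y) (deg x)"
  proof -
    have "b x y / deg x < of_rat 2" 
      using b_le_deg[of x y] True pos by (simp add: field_simps)
    moreover have "(0::rat) < 2" by simp
    ultimately have "\<exists>c::rat. 0 < c \<and> b x y / deg x < of_rat c" by blast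
    then show ?thesis using pos True by (auto simp: comparable_def)
  qed
  finally show ?thesis using True by (auto simp: edges_def neighbors_iff)
next
  case False
  then show ?thesis by (auto simp: edges_def neighbors_iff)
qed

lemma reachable_dominated: "(x, y) \<in> edges\<^sup>* \<Longrightarrow> x \<in> V \<Longrightarrow> dominated (deg x) (deg y)"
proof (induction rule: rtrancl_induct)
  case base
  then show ?case using vdegree_pos dominated_le by blast
next
  case (step y z)
  then have yz: "y \<in> V" "z \<in> V" "comparable (b y z) (deg y)" by (auto simp: edges_iff)
  have "dominated (deg y) (b y z)" using yz by (simp add: comparable_iff)
  moreover have "dominated (b y z) (deg z)"
    using yz b_sym[of y z] b_le_deg[of z y] vdegree_pos by (intro dominated_le) auto
  ultimately show ?case using step dominated_trans by blast
qed

lemma essential_iff: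
  assumes "C \<subseteq> V"
  shows "essential V b C \<longleftrightarrow> (\<forall>x\<in>C. \<forall>y. (x, y) \<in> edges\<^sup>* \<longrightarrow> comparable (deg x) (deg y))"
proof -
  have edges: "edges = {(u, v). u \<in> V \<and> v \<in> V \<and> 0 < b u v \<and> comparable (b u v) (deg u)}"
    by (auto simp: edges_iff comparable_iff)
  have "essential V b C \<longleftrightarrow> (\<forall>x\<in>C. \<forall>y. (\<exists>xs. path_between V b x y xs \<and>
      (\<forall>i. Suc i < length xs \<longrightarrow> comparable (b (xs ! i) (xs ! Suc i)) (deg (xs ! i)))) \<longrightarrow>
      x = y \<or> comparable (deg x) (deg y))"
    unfolding essential_def by blast
  also have "\<dots> \<longleftrightarrow> (\<forall>x\<in>C. \<forall>y. (x, y) \<in> edges\<^sup>* \<longrightarrow> x = y \<or> comparable (deg x) (deg y))"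
    unfolding path_between_iff_rtrancl[of V b _ _ "\<lambda>u v. comparable (b u v) (deg u)"] edges[symmetric]
    using assms by blast
  also have "\<dots> \<longleftrightarrow> (\<forall>x\<in>C. \<forall>y. (x, y) \<in> edges\<^sup>* \<longrightarrow> comparable (deg x) (deg y))"
    using assms comparable_refl vdegree_pos by blast
  finally show ?thesis .
qed

section \<open>Strongly connected components and the real chain\<close>

definition links :: "'v \<Rightarrow> 'v \<Rightarrow> ('v \<times> 'v) set" where
  "links x y = {(u, v). u \<in> V \<and> v \<in> V \<and> 0 < b u v \<and>
    comparable (deg x) (b u v) \<and> comparable (b u v) (deg y)}"

lemma strongly_linked_iff: "strongly_linked V b x y \<longleftrightarrow> x \<in> V \<and> (x, y) \<in> (links x y)\<^sup>*"
  unfolding strongly_linked_def links_def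
  by (rule path_between_iff_rtrancl[of V b x y "\<lambda>u v. comparable (deg x) (b u v) \<and> comparable (b u v) (deg y)"])

lemma strongly_linked_comparable:
  assumes "strongly_linked V b x y"
  shows "comparable (deg x) (deg y)"
proof (cases "x = y")
  case True
  then show ?thesis using assms comparable_refl[OF vdegree_pos] by (simp add: strongly_linked_iff)
next
  case False
  then obtain z where "(x, z) \<in> links x y"
    using assms unfolding strongly_linked_iff by (meson converse_rtranclE)
  then show ?thesis using comparable_trans by (simp add: links_def) blast
qed

text \<open>The edges allowed on a strong link depend on its endpoints, so links cannot simply be
  concatenated. They can once an endpoint may be exchanged for one of comparable degree.\<close>

lemma links_subset:
  assumes "comparable (deg x) (deg x')" "comparable (deg y) (deg y')"
  shows "links x y \<subseteq> links x' y'"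
proof -
  have "comparable (deg x') k" if "comparable (deg x) k" for k
    using comparable_trans[OF comparable_sym[OF assms(1)] that] .
  moreover have "comparable k (deg y')" if "comparable k (deg y)" for k
    using comparable_trans[OF that assms(2)] .
  ultimately show ?thesis by (auto simp: links_def)
qed

text \<open>A strong link may pass through vertices of much larger degree, where the chain does not
  follow it; this is excluded if no such vertex is reachable.\<close>

lemma strongly_linked_reachable:
  assumes reach: "\<And>z. (x, z) \<in> edges\<^sup>* \<Longrightarrow> comparable (deg x) (deg z)"
    and link: "strongly_linked V b x y"
  shows "(x, y) \<in> edges\<^sup>*"
proof -
  have "(x, y) \<in> (links x y)\<^sup>*" using link by (simp add: strongly_linked_iff)
  then show ?thesis
  proof (induction)
    case (step u v)
    then have uv: "u \<in> V" "v \<in> V" "comparable (deg x) (b u v)" by (auto simp: links_def)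
    have "comparable (b u v) (deg u)"
      using uv reach[OF step.IH] comparable_trans comparable_sym by blast
    then have "(u, v) \<in> edges" using uv by (simp add: edges_iff)
    with step.IH show ?case by (rule rtrancl_into_rtrancl)
  qed simp
qed

context
  fixes C :: "'v set"
  assumes component: "strongly_connected_component V b C"
begin

lemma component_subset: "C \<subseteq> V"
  using component by (simp add: strongly_connected_component_def)

lemma component_linked: "x \<in> C \<Longrightarrow> y \<in> C \<Longrightarrow> strongly_linked V b x y"
  using component by (simp add: strongly_connected_component_def)

lemma component_maximal:
  assumes "C \<subseteq> D" "D \<subseteq> V" "\<And>x y. x \<in> D \<Longrightarrow> y \<in> D \<Longrightarrow> strongly_linked V b x y"
  shows "D = C"
  using component assms by (simp add: strongly_connected_component_def)

text \<open>Failure of essentiality is witnessed at some vertex of \<open>C\<close> and has to be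
  moved to the given \<open>x\<close>. If the chain could always return to \<open>x\<close>,
  domination in both directions would make all reachable degrees comparable. Strong links from
  \<open>x\<close> could then be followed, so whatever is reachable from \<open>C\<close> would be
  reachable from \<open>x\<close>, and \<open>C\<close> would be essential.\<close>

lemma non_essential_leaves:
  assumes "\<not> essential V b C" and x: "x \<in> C"
  shows "\<exists>y. (x, y) \<in> edges\<^sup>* \<and> (y, x) \<notin> edges\<^sup>*"
proof (rule ccontr)
  assume "\<not> ?thesis"
  then have returns: "(y, x) \<in> edges\<^sup>*" if "(x, y) \<in> edges\<^sup>*" for y using that by blast
  have xV: "x \<in> V" using x component_subset by blast
  have comp: "comparable (deg x) (deg y)" if "(x, y) \<in> edges\<^sup>*" for y
  proof -
    have "y \<in> V" using edges_rtrancl_in_V[OF that xV] .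
    then show ?thesis
      using reachable_dominated returns[OF that] that xV vdegree_pos by (auto simp: comparable_iff)
  qed
  have "essential V b C"
    unfolding essential_iff[OF component_subset]
  proof (intro ballI allI impI)
    fix w y
    assume w: "w \<in> C" and wy: "(w, y) \<in> edges\<^sup>*"
    have "(x, w) \<in> edges\<^sup>*"
      using strongly_linked_reachable[OF comp component_linked[OF x w]] .
    then have "comparable (deg x) (deg w)" "comparable (deg x) (deg y)"
      using comp rtrancl_trans[OF _ wy] by blast+
    then show "comparable (deg w) (deg y)" using comparable_sym comparable_trans by blast
  qed
  with assms show False by blast
qed

lemma non_essential_transient:
  assumes "\<not> essential V b C" and x: "x \<in> C"
  shows "\<not> recurrent_vertex V (real_trans V b) x"
proof -
  have xV: "x \<in> V" using x component_subset by blast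
  obtain y where y: "(x, y) \<in> edges\<^sup>*" "(y, x) \<notin> edges\<^sup>*"
    using non_essential_leaves[OF assms] by blast
  have "escape x y = 1" using edges_rtrancl_in_V[OF y(1) xV] y(2) by (rule escape_not_reachable)
  then show ?thesis
    using escape_eq_0_reachable[OF xV _ y(1)] recurrent_vertex_iff[OF xV] by auto
qed

context
  assumes ess: "essential V b C"
begin

lemma essential_reachable: "x \<in> C \<Longrightarrow> y \<in> C \<Longrightarrow> (x, y) \<in> edges\<^sup>*"
  using strongly_linked_reachable component_linked ess
  unfolding essential_iff[OF component_subset] by blast

text \<open>Essentiality makes the degree of \<open>y\<close> comparable with those in
  \<open>C\<close>, and the weight of the edge is comparable with all of them. So the edge prolongs
  the strong links to and from \<open>x\<close>, and maximality of \<open>C\<close> absorbs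
  \<open>y\<close>.\<close>

lemma essential_closed:
  assumes x: "x \<in> C" and xy: "(x, y) \<in> edges"
  shows "y \<in> C"
proof -
  have V: "x \<in> V" "y \<in> V" "comparable (b x y) (deg x)" using xy by (auto simp: edges_iff)
  have "comparable (deg x) (deg y)"
    using x xy ess unfolding essential_iff[OF component_subset] by blast
  note comp = this comparable_sym[OF this]
  have "0 < b x y" using V by (simp add: comparable_iff)
  have "links z x \<subseteq> links z y" "(x, y) \<in> links z y"
    "links x z \<subseteq> links y z" "(y, x) \<in> links y z" if "z \<in> C" for z
  proof -
    have z: "comparable (deg z) (deg x)" "comparable (deg x) (deg z)"
      using component_linked strongly_linked_comparable x that by blast+
    then have refl: "comparable (deg z) (deg z)" using comparable_trans by blast
    show "links z x \<subseteq> links z y" "links x z \<subseteq> links y z"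
      using links_subset refl comp by blast+
    have "comparable (b x y) (deg z)" "comparable (b x y) (deg y)"
      using V(3) z comp comparable_trans by blast+
    note weights = this comparable_sym[OF this(1)] comparable_sym[OF this(2)]
    then show "(x, y) \<in> links z y" "(y, x) \<in> links y z"
      using V \<open>0 < b x y\<close> b_sym[of x y] weights by (simp_all add: links_def)
  qed note links = this
  have zy: "strongly_linked V b z y" if "z \<in> C" for z
    using component_linked[OF that x] rtrancl_mono[OF links(1)[OF that]] links(2)[OF that]
    unfolding strongly_linked_iff by (meson rtrancl_into_rtrancl subsetD)
  have yz: "strongly_linked V b y z" if "z \<in> C" for z
    using component_linked[OF x that] rtrancl_mono[OF links(3)[OF that]] links(4)[OF that] V
    unfolding strongly_linked_iff by (meson converse_rtrancl_into_rtrancl subsetD)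
  have "strongly_linked V b y y" using V by (simp add: strongly_linked_iff)
  then have "insert y C = C"
    using component_subset V zy yz component_linked by (intro component_maximal) auto
  then show ?thesis by blast
qed

lemma essential_recurrent_transfer:
  assumes x: "x \<in> C" and y: "y \<in> C" and rec: "recurrent_vertex V (real_trans V b) x"
  shows "recurrent_vertex V (real_trans V b) y"
proof -
  have V: "x \<in> V" "y \<in> V" using x y component_subset by blast+
  show ?thesis
    using escape_eq_0_transfer[OF V(1) _ essential_reachable[OF x y]] rec
    unfolding recurrent_vertex_iff[OF V(1)] recurrent_vertex_iff[OF V(2)] by blast
qed

end
end
end

subsection \<open>Capacity and escape probability\<close>

context weighted_network
begin

lemma laplacian_eq_0_iff:
  assumes "x \<in> V"
  shows "laplacian V b v x = 0 \<longleftrightarrow> (\<Sum>y\<in>neighbors V b x. b x y * (v y - v x)) = 0"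
proof -
  have "(\<Sum>y\<in>neighbors V b x. b x y * (v y - v x)) = - (\<Sum>y\<in>neighbors V b x. b x y * (v x - v y))"
    unfolding sum_negf[symmetric] by (rule sum.cong) (auto simp: algebra_simps)
  then show ?thesis using vdegree_pos[OF assms] by (simp add: laplacian_def)
qed

lemma laplacian_eq:
  assumes "x \<in> V"
  shows "laplacian V b v x = v x - (\<Sum>y\<in>neighbors V b x. trans_prob V b x y * v y)"
proof -
  have "laplacian V b v x = (\<Sum>y\<in>neighbors V b x. trans_prob V b x y * v x - trans_prob V b x y * v y)"
    unfolding laplacian_def sum_distrib_left
    by (rule sum.cong) (auto simp: trans_prob_def right_diff_distrib)
  also have "\<dots> = v x - (\<Sum>y\<in>neighbors V b x. trans_prob V b x y * v y)"
    using sum_trans_prob[OF assms] by (simp add: sum_subtractf flip: sum_distrib_right)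
  finally show ?thesis .
qed

section \<open>Potentials and exit probabilities for a finite connected set\<close>

context
  fixes K :: "'v set" and a :: 'v
  assumes finite_K: "finite K" and connected_K: "connected_on K b"
    and K_subset: "K \<subseteq> V" and a_in_K: "a \<in> K"
begin

lemma maximum_principle:
  assumes A: "A \<subseteq> K - {a}"
    and harmonic: "\<And>x. x \<in> A \<Longrightarrow> (\<Sum>y\<in>neighbors V b x. b x y * (u y - u x)) = 0"
    and boundary: "\<And>x. x \<notin> A \<Longrightarrow> u x \<le> 0"
  shows "u x \<le> 0"
proof (cases "x \<in> A")
  case True
  have AV: "y \<in> V" if "y \<in> A" for y using that A K_subset by blast
  show ?thesis
  proof (rule discrete_maximum_principle[of A "neighbors V b" b u])
    show "finite A" using finite_K A by (meson finite_Diff finite_subset)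
    show "finite (neighbors V b y)" if "y \<in> A" for y using finite_neighbors AV that by blast
    show "0 \<le> b y z" if "y \<in> A" "z \<in> neighbors V b y" for y z
      using that by (simp add: neighbors_iff less_imp_le)
    show "0 \<le> (\<Sum>z\<in>neighbors V b y. b y z * (u z - u y))" if "y \<in> A" for y
      using harmonic[OF that] by simp
    show "\<exists>z. z \<notin> A \<and> (y, z) \<in> {(y, z). z \<in> neighbors V b y \<and> 0 < b y z}\<^sup>*" if "y \<in> A" for y
    proof (intro exI conjI)
      show "a \<notin> A" using A by blast
      have "y \<in> K" using that A by blast
      then obtain xs where "path_between K b y a xs"
        using connected_K a_in_K by (auto simp: connected_on_def)
      then have "(y, a) \<in> {(u, v). u \<in> K \<and> v \<in> K \<and> 0 < b u v \<and> True}\<^sup>*"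
        using path_between_iff_rtrancl[of K b y a "\<lambda>_ _. True"] by blast
      moreover have "{(u, v). u \<in> K \<and> v \<in> K \<and> 0 < b u v \<and> True}\<^sup>* \<subseteq>
          {(y, z). z \<in> neighbors V b y \<and> 0 < b y z}\<^sup>*"
        using K_subset by (intro rtrancl_mono) (auto simp: neighbors_iff)
      ultimately show "(y, a) \<in> {(y, z). z \<in> neighbors V b y \<and> 0 < b y z}\<^sup>*" by blast
    qed
  qed (use True boundary in auto)
qed (rule boundary)

lemma zero_if_harmonic:
  assumes A: "A \<subseteq> K - {a}"
    and harmonic: "\<And>x. x \<in> A \<Longrightarrow> (\<Sum>y\<in>neighbors V b x. b x y * (u y - u x)) = 0"
    and boundary: "\<And>x. x \<notin> A \<Longrightarrow> u x = 0"
  shows "u = (\<lambda>_. 0)"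
proof
  fix x
  have "(\<Sum>y\<in>neighbors V b z. b z y * (- u y - (- u z))) = 0" if "z \<in> A" for z
  proof -
    have "(\<Sum>y\<in>neighbors V b z. b z y * (- u y - (- u z))) =
        - (\<Sum>y\<in>neighbors V b z. b z y * (u y - u z))"
      unfolding sum_negf[symmetric] by (rule sum.cong) (auto simp: algebra_simps)
    then show ?thesis using harmonic[OF that] by simp
  qed
  then have "- u x \<le> 0" by (rule maximum_principle[OF A]) (use boundary in auto)
  moreover have "u x \<le> 0" by (rule maximum_principle[OF A harmonic]) (use boundary in auto)
  ultimately show "u x = 0" by simp
qed

lemma potential_ex1:
  "\<exists>!v. (\<forall>x\<in>K - {a}. laplacian V b v x = 0) \<and> v a = 1 \<and> (\<forall>x. x \<notin> K \<longrightarrow> v x = 0)"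
proof (rule ex_ex1I)
  have V: "x \<in> V" if "x \<in> K - {a}" for x using that K_subset by blast
  define T where "T u x = (\<Sum>y\<in>neighbors V b x. b x y * (u y - u x))" for u x
  have linear: "T (\<lambda>z. u z + c * w z) x = T u x + c * T w x" for u w c x
    unfolding T_def sum_distrib_left sum.distrib[symmetric]
    by (rule sum.cong) (auto simp: algebra_simps)
  have "\<exists>v. (\<forall>x. x \<notin> K - {a} \<longrightarrow> v x = (if x = a then 1 else 0)) \<and> (\<forall>x\<in>K - {a}. T v x = 0)"
  proof (rule dirichlet_problem_solvable[of "K - {a}" T "\<lambda>x. if x = a then 1 else 0", OF _ linear])
    show "u = (\<lambda>_. 0)"
      if "A \<subseteq> K - {a}" "\<And>x. x \<notin> A \<Longrightarrow> u x = 0" "\<And>x. x \<in> A \<Longrightarrow> T u x = 0" for A u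
      using that(1) that(3)[unfolded T_def] that(2) by (rule zero_if_harmonic)
  qed (use finite_K in simp)
  then obtain v where v: "\<And>x. x \<notin> K - {a} \<Longrightarrow> v x = (if x = a then 1 else 0)"
    "\<And>x. x \<in> K - {a} \<Longrightarrow> T v x = 0" by blast
  have "laplacian V b v x = 0" if "x \<in> K - {a}" for x
    using laplacian_eq_0_iff[OF V[OF that]] v(2)[OF that] unfolding T_def by blast
  moreover have "v a = 1" "\<forall>x. x \<notin> K \<longrightarrow> v x = 0" using v(1) a_in_K by auto
  ultimately show "\<exists>v. (\<forall>x\<in>K - {a}. laplacian V b v x = 0) \<and> v a = 1 \<and> (\<forall>x. x \<notin> K \<longrightarrow> v x = 0)"
    by blast
  fix v w
  assume v: "(\<forall>x\<in>K - {a}. laplacian V b v x = 0) \<and> v a = 1 \<and> (\<forall>x. x \<notin> K \<longrightarrow> v x = 0)"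
    and w: "(\<forall>x\<in>K - {a}. laplacian V b w x = 0) \<and> w a = 1 \<and> (\<forall>x. x \<notin> K \<longrightarrow> w x = 0)"
  have "(\<lambda>x. v x + (- 1) * w x) = (\<lambda>_. 0)"
  proof (rule zero_if_harmonic[OF order_refl])
    fix x
    assume x: "x \<in> K - {a}"
    have "T v x = 0" "T w x = 0"
      using v w x laplacian_eq_0_iff[OF V[OF x]] unfolding T_def by blast+
    then show "(\<Sum>y\<in>neighbors V b x. b x y * (v y + (- 1) * w y - (v x + (- 1) * w x))) = 0"
      using linear[of v "- 1" w x] unfolding T_def by simp
  next
    fix x
    assume "x \<notin> K - {a}"
    then show "v x + (- 1) * w x = 0" using v w by (cases "x = a") auto
  qed
  then show "v = w" by (auto simp: fun_eq_iff)
qed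

lemma potential_laplacian: "x \<in> K \<Longrightarrow> x \<noteq> a \<Longrightarrow> laplacian V b (potential V b K a) x = 0"
  and potential_source: "potential V b K a a = 1"
  and potential_outside: "x \<notin> K \<Longrightarrow> potential V b K a x = 0"
  using theI'[OF potential_ex1] unfolding potential_def[symmetric] by simp_all

lemma potential_harmonic:
  assumes "x \<in> K" "x \<noteq> a"
  shows "potential V b K a x =
    (\<Sum>y\<in>neighbors V b x. trans_prob V b x y * potential V b K a y)"
  using potential_laplacian[OF assms] laplacian_eq[of x] assms K_subset by auto

lemma potential_bounds: "0 \<le> potential V b K a x" "potential V b K a x \<le> 1"
proof -
  have harm: "(\<Sum>y\<in>neighbors V b z. b z y * (potential V b K a y - potential V b K a z)) = 0"
    if "z \<in> K - {a}" for z
    using that laplacian_eq_0_iff[of z] potential_laplacian[of z] K_subset by blast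
  have out: "potential V b K a z = (if z = a then 1 else 0)" if "z \<notin> K - {a}" for z
    using that potential_source potential_outside by auto
  have "potential V b K a x - 1 \<le> 0"
    by (rule maximum_principle[OF order_refl]) (use harm out in auto)
  then show "potential V b K a x \<le> 1" by simp
  have "(\<Sum>y\<in>neighbors V b z. b z y * (- potential V b K a y - (- potential V b K a z))) = 0"
    if "z \<in> K - {a}" for z
  proof -
    have "(\<Sum>y\<in>neighbors V b z. b z y * (- potential V b K a y - (- potential V b K a z))) =
        - (\<Sum>y\<in>neighbors V b z. b z y * (potential V b K a y - potential V b K a z))"
      unfolding sum_negf[symmetric] by (rule sum.cong) (auto simp: algebra_simps)
    then show ?thesis using harm[OF that] by simp
  qed
  then have "- potential V b K a x \<le> 0"
    by (rule maximum_principle[OF order_refl]) (use out in auto)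
  then show "0 \<le> potential V b K a x" by simp
qed

text \<open>The probability of leaving \<open>K\<close> before visiting \<open>a\<close>, provided
  that \<open>x\<close> lies in an essential component containing \<open>a\<close>. Elsewhere the
  real chain may be trapped in \<open>K\<close> away from \<open>a\<close>, and the value depends on
  the infinitesimal transitions.\<close>

definition exit_prob :: "'v \<Rightarrow> real" where
  "exit_prob x = 1 - real_part (potential V b K a x)"

lemma close_potential: "infinitely_close (potential V b K a x) (real_part (potential V b K a x))"
  by (intro infinitely_close_real_part_unit potential_bounds)

lemma exit_prob_bounds: "0 \<le> exit_prob x" "exit_prob x \<le> 1"
  using real_part_unit_bounds[OF potential_bounds[of x]] by (simp_all add: exit_prob_def)

lemma exit_prob_source: "exit_prob a = 0"
  using real_part_eqI[OF infinitely_close_1] by (simp add: exit_prob_def potential_source)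

lemma exit_prob_outside: "x \<notin> K \<Longrightarrow> exit_prob x = 1"
  using real_part_eqI[OF infinitely_close_0] by (simp add: exit_prob_def potential_outside)

text \<open>Averaging with the transition matrix commutes with taking real parts. At vertices of
  \<open>K - {a}\<close> this makes \<open>exit_prob\<close> harmonic, and at \<open>a\<close> it
  evaluates the capacity.\<close>

lemma close_exit_prob_sum:
  assumes x: "x \<in> V"
  shows "infinitely_close (1 - (\<Sum>y\<in>neighbors V b x. trans_prob V b x y * potential V b K a y))
    (\<Sum>y\<in>neighbors V b x. real_trans V b x y * exit_prob y)"
proof -
  have "infinitely_close (1 - (\<Sum>y\<in>neighbors V b x. trans_prob V b x y * potential V b K a y))
    (1 - (\<Sum>y\<in>neighbors V b x. real_trans V b x y * real_part (potential V b K a y)))"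
    using x
    by (intro infinitely_close_diff infinitely_close_1 infinitely_close_sum infinitely_close_mult
        close_real_trans close_potential) (auto simp: neighbors_iff)
  moreover have "(\<Sum>y\<in>neighbors V b x. real_trans V b x y * exit_prob y) =
    1 - (\<Sum>y\<in>neighbors V b x. real_trans V b x y * real_part (potential V b K a y))"
    using sum_N[OF x] by (simp add: exit_prob_def right_diff_distrib sum_subtractf)
  ultimately show ?thesis by simp
qed

lemma exit_prob_harmonic:
  assumes "x \<in> K" "x \<noteq> a"
  shows "exit_prob x = (\<Sum>y\<in>neighbors V b x. real_trans V b x y * exit_prob y)"
proof -
  have x: "x \<in> V" using assms K_subset by blast
  have "infinitely_close (1 - potential V b K a x) (exit_prob x)"
    unfolding exit_prob_def by (intro infinitely_close_diff infinitely_close_1 close_potential)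
  then have "real_part (1 - potential V b K a x) = exit_prob x" by (rule real_part_eqI)
  moreover have "real_part (1 - potential V b K a x) =
      (\<Sum>y\<in>neighbors V b x. real_trans V b x y * exit_prob y)"
    using close_exit_prob_sum[OF x] unfolding potential_harmonic[OF assms, symmetric]
    by (rule real_part_eqI)
  ultimately show ?thesis by simp
qed

lemma green_eq:
  "green V b K a = 1 / ereal (\<Sum>y\<in>neighbors V b a. real_trans V b a y * exit_prob y)"
proof -
  have a: "a \<in> V" using a_in_K K_subset by blast
  have "capacity V b K a / deg a =
      1 - (\<Sum>y\<in>neighbors V b a. trans_prob V b a y * potential V b K a y)"
    using vdegree_pos[OF a] laplacian_eq[OF a] potential_source by (simp add: capacity_def)
  then show ?thesis
    using real_part_eqI[OF close_exit_prob_sum[OF a]] by (simp add: green_def)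
qed

end

end

section \<open>Passage to the limit along an exhaustion\<close>

lemma limsup_inverse_eq_infinity_iff:
  fixes r :: "nat \<Rightarrow> real"
  assumes r: "r \<longlonglongrightarrow> l" and nonneg: "\<And>n. 0 \<le> r n"
  shows "limsup (\<lambda>n. 1 / ereal (r n)) = \<infinity> \<longleftrightarrow> l = 0"
proof
  assume "l = 0"
  have "(\<lambda>n. 1 / ereal (r n)) \<longlonglongrightarrow> \<infinity>"
    unfolding tendsto_PInfty
  proof
    fix B :: real
    \<comment> \<open>Raising the bound to at least 1 makes \<open>1 / B'\<close> a positive
      threshold even for negative \<open>B\<close>.\<close>
    define B' where "B' = max B 1"
    have B': "0 < B'" "B \<le> B'" by (auto simp: B'_def)
    have "\<forall>\<^sub>F n in sequentially. r n < 1 / B'"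
      using order_tendstoD(2)[OF r, of "1 / B'"] \<open>l = 0\<close> B' by simp
    then show "\<forall>\<^sub>F n in sequentially. ereal B < 1 / ereal (r n)"
    proof eventually_elim
      case (elim n)
      show ?case
      proof (cases "r n = 0")
        case False
        then have "0 < r n" using nonneg[of n] by simp
        then have "B' < 1 / r n" using elim B' by (simp add: field_simps)
        then show ?thesis using False B'(2) by (simp add: one_ereal_def)
      qed (simp add: one_ereal_def)
    qed
  qed
  then show "limsup (\<lambda>n. 1 / ereal (r n)) = \<infinity>"
    by (simp add: lim_imp_Limsup)
next
  assume inf: "limsup (\<lambda>n. 1 / ereal (r n)) = \<infinity>"
  show "l = 0"
  proof (rule ccontr)
    assume "l \<noteq> 0"
    moreover have "0 \<le> l" using r nonneg by (intro LIMSEQ_le_const[OF r]) auto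
    ultimately have l: "0 < l / 2" "l / 2 < l" by auto
    have "\<forall>\<^sub>F n in sequentially. l / 2 < r n" using order_tendstoD(1)[OF r l(2)] .
    then have "\<forall>\<^sub>F n in sequentially. 1 / ereal (r n) \<le> ereal (2 / l)"
    proof eventually_elim
      case (elim n)
      then have "0 < r n" "1 / r n \<le> 2 / l" using l by (auto simp: field_simps)
      then show ?case by (simp add: one_ereal_def)
    qed
    then have "limsup (\<lambda>n. 1 / ereal (r n)) \<le> ereal (2 / l)" by (rule Limsup_bounded)
    with inf show False by simp
  qed
qed

lemma (in weighted_network) essential_recurrent_iff_green:
  assumes component: "strongly_connected_component V b C" and ess: "essential V b C"
    and a: "a \<in> C" and K: "exhaustion V b K" "a \<in> K 0"
  shows "recurrent_vertex V (real_trans V b) a \<longleftrightarrow> green_limit V b K a = \<infinity>"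
proof -
  have C: "C \<subseteq> V" using component_subset[OF component] .
  have aV: "a \<in> V" using a C by blast
  have mono: "K m \<subseteq> K n" if "m \<le> n" for m n
    using K that by (auto simp: exhaustion_def incseq_def)
  have Km: "finite (K m)" "connected_on (K m) b" "K m \<subseteq> V" "a \<in> K m" for m
    using K mono[of 0 m] by (auto simp: exhaustion_def)
  define r where "r m = (\<Sum>y\<in>neighbors V b a. real_trans V b a y * exit_prob (K m) a y)" for m
  have "r \<longlonglongrightarrow> escape a a"
    unfolding r_def
  proof (rule exit_probability_tendsto_escape[of a C K])
    show "\<And>y z. y \<in> C \<Longrightarrow> (y, z) \<in> edges \<Longrightarrow> z \<in> C"
      by (rule essential_closed[OF component ess])
    show "\<And>y. y \<in> C \<Longrightarrow> (y, a) \<in> edges\<^sup>*"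
      using essential_reachable[OF component ess _ a] .
    show "\<forall>\<^sub>F m in sequentially. y \<in> K m" if "y \<in> C" for y
    proof -
      have "y \<in> (\<Union>n. K n)" using that C K by (auto simp: exhaustion_def)
      then obtain n where "y \<in> K n" by blast
      then show ?thesis using mono unfolding eventually_sequentially by blast
    qed
  qed (use a C Km exit_prob_bounds[OF Km] exit_prob_source[OF Km] exit_prob_outside[OF Km]
      exit_prob_harmonic[OF Km] in auto)
  moreover have "0 \<le> r m" for m
    unfolding r_def using nonneg_N[OF aV] exit_prob_bounds[OF Km]
    by (intro sum_nonneg mult_nonneg_nonneg) auto
  ultimately have "limsup (\<lambda>m. 1 / ereal (r m)) = \<infinity> \<longleftrightarrow> escape a a = 0"
    by (rule limsup_inverse_eq_infinity_iff)
  then show ?thesis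
    unfolding green_limit_def green_eq[OF Km] recurrent_vertex_iff[OF aV] r_def by blast
qed

text \<open>The first edge of a path to another vertex has positive weight. Only the one-point graph
  escapes this and has to be treated by hand.\<close>

lemma connected_vdegree_pos:
  assumes graph: "weighted_graph V b" "locally_finite V b" "connected_on V b"
    and x: "x \<in> V" and V: "V \<noteq> {x}"
  shows "0 < vdegree V b x"
proof -
  obtain y where y: "y \<in> V" "y \<noteq> x" using x V by blast
  have "\<exists>xs. path_between V b x y xs" using graph x y by (simp add: connected_on_def)
  then have "(x, y) \<in> {(u, v). u \<in> V \<and> v \<in> V \<and> 0 < b u v \<and> True}\<^sup>*"
    using path_between_iff_rtrancl[of V b x y "\<lambda>_ _. True"] by blast
  then obtain z where z: "z \<in> V" "0 < b x z" using y(2) by (auto elim: converse_rtranclE)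
  then show ?thesis
    unfolding vdegree_def using graph x
    by (intro sum_pos) (auto simp: neighbors_def locally_finite_def)
qed

text \<open>Both path events are the whole sample space, so the Markov property with the entry 0
  reads 1 = 1 * 0: there is no realization.\<close>

lemma singleton_recurrent:
  assumes graph: "weighted_graph {x} b"
  shows "recurrent_vertex {x} (real_trans {x} b) x"
  unfolding recurrent_vertex_def
proof (intro allI impI)
  fix M :: "(nat \<Rightarrow> 'v) measure" and X
  assume chain: "markov_chain {x} (real_trans {x} b) x M X"
  then have prob: "prob_space M" and meas: "\<And>n. X n \<in> measurable M (count_space {x})"
    and step: "measure M {\<omega> \<in> space M. \<forall>i\<le>Suc 0. X i \<omega> = x} =
      measure M {\<omega> \<in> space M. \<forall>i\<le>0. X i \<omega> = x} * real_trans {x} b x x"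
    unfolding markov_chain_def by auto
  have "X n \<omega> = x" if "\<omega> \<in> space M" for n \<omega> using measurable_space[OF meas that] by simp
  then have "{\<omega> \<in> space M. \<forall>i\<le>n. X i \<omega> = x} = space M" for n by auto
  moreover have "real_trans {x} b x x = 0"
    using graph real_part_eqI[OF infinitely_close_0]
    by (simp add: real_trans_def trans_prob_def weighted_graph_def)
  ultimately show "measure M {\<omega> \<in> space M. infinite {n. X n \<omega> = x}} = 1"
    using step prob_space.prob_space[OF prob] by simp
qed

text \<open>Division by the degree 0 gives 0 whatever the potential is, and 1 / 0 is \<infinity> in
  \<open>ereal\<close>.\<close>

lemma singleton_green_limit:
  assumes graph: "weighted_graph {x} b"
  shows "green_limit {x} b K x = \<infinity>"
proof -
  have "vdegree {x} b x = 0"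
    using graph by (simp add: vdegree_def neighbors_def weighted_graph_def)
  then have "green {x} b (K n) x = \<infinity>" for n
    by (simp add: green_def real_part_eqI[OF infinitely_close_0] one_ereal_def)
  then show ?thesis by (simp add: green_limit_def Limsup_const)
qed

lemma singleton_essential:
  assumes "C \<subseteq> {x}"
  shows "essential {x} b C"
  unfolding essential_def
proof (intro ballI allI impI disjI1)
  fix u y xs
  assume "u \<in> C" and path: "path_between {x} b u y xs \<and>
    (\<forall>i. Suc i < length xs \<longrightarrow> comparable (b (xs ! i) (xs ! Suc i)) (vdegree {x} b (xs ! i)))"
  then have "xs \<noteq> []" "set xs \<subseteq> {x}" "hd xs = u" "last xs = y" by (auto simp: path_between_def)
  then have "u = x" "y = x" using hd_in_set last_in_set by fast+
  then show "u = y" by simp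
qed

text \<open>The path of length 0 links each vertex to itself, so the empty set is not maximal.
  Without a vertex in \<open>C\<close>, the existential and the universal statements would
  differ.\<close>

lemma component_nonempty:
  assumes "V \<noteq> {}" and C: "strongly_connected_component V b C"
  shows "C \<noteq> {}"
proof
  assume "C = {}"
  obtain x where x: "x \<in> V" using assms by blast
  then have "strongly_linked V b x x"
    unfolding strongly_linked_def by (intro exI[of _ "[x]"]) (simp add: path_between_def)
  moreover have "C \<subseteq> D \<and> D \<subseteq> V \<and> (\<forall>x\<in>D. \<forall>y\<in>D. strongly_linked V b x y) \<longrightarrow> D = C" for D
    using C by (simp add: strongly_connected_component_def)
  from this[of "{x}"] have "strongly_linked V b x x \<longrightarrow> {x} = C"
    using \<open>C = {}\<close> x by simp
  ultimately show False using \<open>C = {}\<close> by blast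
qed

text \<open>The exhaustion is indexed by \<open>a\<close> because its first set has to contain
  \<open>a\<close>; any choice for each vertex is allowed.\<close>

theorem corollary5p5:
  fixes V C :: "'v set" and b :: "'v \<Rightarrow> 'v \<Rightarrow> 'k::linordered_field"
    and K :: "'v \<Rightarrow> nat \<Rightarrow> 'v set"
  assumes "V \<noteq> {}" and "countable V"
    and "weighted_graph V b" and "locally_finite V b" and "connected_on V b"
    and "strongly_connected_component V b C"
    and "\<And>a. a \<in> C \<Longrightarrow> exhaustion V b (K a) \<and> a \<in> K a 0"
  shows
    "(recurrent_set V (real_trans V b) C \<longleftrightarrow>
        essential V b C \<and> (\<exists>a\<in>C. green_limit V b (K a) a = \<infinity>)) \<and>
     (recurrent_set V (real_trans V b) C \<longleftrightarrow>
        essential V b C \<and> (\<forall>a\<in>C. green_limit V b (K a) a = \<infinity>)) \<and>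
     (transient_set V (real_trans V b) C \<longleftrightarrow>
        \<not> essential V b C \<or> (\<exists>a\<in>C. green_limit V b (K a) a < \<infinity>)) \<and>
     (transient_set V (real_trans V b) C \<longleftrightarrow>
        \<not> essential V b C \<or> (\<forall>a\<in>C. green_limit V b (K a) a < \<infinity>))"
proof -
  let ?rec = "recurrent_vertex V (real_trans V b)"
  have ne: "C \<noteq> {}" using assms(1,6) by (rule component_nonempty)
  have C: "C \<subseteq> V" using assms(6) by (simp add: strongly_connected_component_def)
  \<comment> \<open>All four equivalences are logical consequences of this fact and
    \<open>C \<noteq> {}\<close>: recurrence passes between the vertices of an essential component,
    which makes some and all agree.\<close>
  have key: "(essential V b C \<longrightarrow> (\<forall>a\<in>C. (?rec a \<longleftrightarrow> green_limit V b (K a) a = \<infinity>)) \<and>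
        (\<forall>x\<in>C. \<forall>y\<in>C. ?rec x \<longrightarrow> ?rec y)) \<and>
      (\<not> essential V b C \<longrightarrow> (\<forall>a\<in>C. \<not> ?rec a))"
  proof (cases "\<exists>x. V = {x}")
    case True
    then obtain x where V: "V = {x}" by blast
    then have Cx: "C = {x}" using C ne by blast
    have graph: "weighted_graph {x} b" using assms(3) unfolding V .
    have "essential {x} b {x}" by (rule singleton_essential) simp
    then show ?thesis
      unfolding V Cx using singleton_recurrent[OF graph] singleton_green_limit[OF graph, of "K x"]
      by simp
  next
    case False
    interpret weighted_network V b
    proof
      show "0 < vdegree V b x" if "x \<in> V" for x
        using connected_vdegree_pos[OF assms(3-5) that] False by blast
    qed (fact assms)+
    show ?thesis
    proof (intro conjI impI ballI)
      fix a
      assume ess: "essential V b C" and a: "a \<in> C"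
      show "?rec a \<longleftrightarrow> green_limit V b (K a) a = \<infinity>"
        using assms(7)[OF a] by (intro essential_recurrent_iff_green[OF assms(6) ess a]) auto
    next
      fix x y
      assume "essential V b C" "x \<in> C" "y \<in> C" "?rec x"
      then show "?rec y" by (rule essential_recurrent_transfer[OF assms(6)])
    next
      fix a
      assume "\<not> essential V b C" "a \<in> C"
      then show "\<not> ?rec a" by (rule non_essential_transient[OF assms(6)])
    qed
  qed
  have "green_limit V b (K a) a < \<infinity> \<longleftrightarrow> green_limit V b (K a) a \<noteq> \<infinity>" for a by auto
  then show ?thesis
    using key ne unfolding recurrent_set_def transient_set_def by blast
qed

end
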